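(* Let $\Phi=(\phi,\overline{\phi},\phi_0):\mathcal{V}\to\mathcal{V}'$ be a strong monoidal equivalence between monoidal categories, and let $\mathbb{S}=(S,e_S,m_S)$ be a monoid in $\mathcal{V}$. Then the map $$\phi_{\mathbb{S}}:\mathbf{I}^l_{\mathcal{V}}(\mathbb{S})\to\mathbf{I}^l_{\mathcal{V}'}(\phi(\mathbb{S})),\qquad [(J,i_J)]\mapsto[(\phi(J),\phi(i_J))]$$ is bijective. Moreover, when $e_S:I\to S$ is right pure (i.e. $e_S\otimes Z$ is a monomorphism for every object $Z$ of $\mathcal{V}$), this bijection is an isomorphism of monoids.
   Context: A strong monoidal functor $\Phi=(\phi,\overline{\phi},\phi_0)$ consists of a functor $\phi$ with coherent natural isomorphisms $\overline{\phi}_{X,Y}:\phi(X)\otimes'\phi(Y)\to\phi(X\otimes Y)$ and an isomorphism $\phi_0:I'\to\phi(I)$; it is a strong monoidal equivalence if there is a strong monoidal functor $\Phi':\mathcal{V}'\to\mathcal{V}$ with monoidal natural isomorphisms $1\cong\phi\phi'$ and $\phi'\phi\cong 1$. For a monoid $\mathbb{S}$ in $\mathcal{V}$, $\phi(\mathbb{S})$ is the monoid $(\phi(S),\phi(e_S)\cdot\phi_0,\phi(m_S)\cdot\overline{\phi}_{S,S})$ in $\mathcal{V}'$. For a monoid $\mathbb{S}=(S,e_S,m_S)$ in a monoidal category $\mathcal{V}$, $\mathbf{I}^l_{\mathcal{V}}(\mathbb{S})$ denotes the class of those subobjects $[(J,i_J:J\to S)]$ of $S$ (equivalence classes of monomorphisms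 into $S$) for which $m_S\cdot(S\otimes i_J):S\otimes J\to S$ is an isomorphism. When $e_S$ is right pure, it is a monoid with product $[(J_1,i_{J_1})]\cdot[(J_2,i_{J_2})]=[(J_1\otimes J_2,\,m_S\cdot(i_{J_1}\otimes i_{J_2}))]$ and unit $[(I,e_S)]$. *)

theory Defs
  imports "HOL-Algebra.Group"
begin

section \<open>Categories\<close>

text \<open>The category is given by the sets of objects and arrows; values of the operations outside
  these sets are irrelevant. Composition is in applicative order: \<open>g \<cdot> f\<close> is \<open>g\<close> after \<open>f\<close>.\<close>

record ('o, 'a) category =
  Obj :: "'o set"
  Arr :: "'a set"
  Dom :: "'a \<Rightarrow> 'o"
  Cod :: "'a \<Rightarrow> 'o"
  Ident :: "'o \<Rightarrow> 'a"
  Comp :: "'a \<Rightarrow> 'a \<Rightarrow> 'a"  (infixl "\<cdot>\<index>" 70)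

definition Hom :: "('o, 'a, 'm) category_scheme \<Rightarrow> 'o \<Rightarrow> 'o \<Rightarrow> 'a set" where
  "Hom C X Y = {f \<in> Arr C. Dom C f = X \<and> Cod C f = Y}"

locale category =
  fixes C :: "('o, 'a, 'm) category_scheme" (structure)
  assumes dom_obj: "f \<in> Arr C \<Longrightarrow> Dom C f \<in> Obj C"
    and cod_obj: "f \<in> Arr C \<Longrightarrow> Cod C f \<in> Obj C"
    and ident_hom: "X \<in> Obj C \<Longrightarrow> Ident C X \<in> Hom C X X"
    and comp_hom: "\<lbrakk>f \<in> Hom C X Y; g \<in> Hom C Y Z\<rbrakk> \<Longrightarrow> g \<cdot> f \<in> Hom C X Z"
    and comp_assoc:
      "\<lbrakk>f \<in> Hom C W X; g \<in> Hom C X Y; h \<in> Hom C Y Z\<rbrakk> \<Longrightarrow> (h \<cdot> g) \<cdot> f = h \<cdot> (g \<cdot> f)"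
    and ident_left: "f \<in> Hom C X Y \<Longrightarrow> Ident C Y \<cdot> f = f"
    and ident_right: "f \<in> Hom C X Y \<Longrightarrow> f \<cdot> Ident C X = f"

definition is_iso :: "('o, 'a, 'm) category_scheme \<Rightarrow> 'a \<Rightarrow> bool" where
  "is_iso C f \<longleftrightarrow> f \<in> Arr C \<and>
     (\<exists>g \<in> Hom C (Cod C f) (Dom C f).
        g \<cdot>\<^bsub>C\<^esub> f = Ident C (Dom C f) \<and> f \<cdot>\<^bsub>C\<^esub> g = Ident C (Cod C f))"

definition is_mono :: "('o, 'a, 'm) category_scheme \<Rightarrow> 'a \<Rightarrow> bool" where
  "is_mono C f \<longleftrightarrow> f \<in> Arr C \<and>
     (\<forall>W. \<forall>g \<in> Hom C W (Dom C f). \<forall>h \<in> Hom C W (Dom C f).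
        f \<cdot>\<^bsub>C\<^esub> g = f \<cdot>\<^bsub>C\<^esub> h \<longrightarrow> g = h)"

definition monos_into :: "('o, 'a, 'm) category_scheme \<Rightarrow> 'o \<Rightarrow> ('o \<times> 'a) set" where
  "monos_into C S = {(J, i). i \<in> Hom C J S \<and> is_mono C i}"

definition subobj_rel ::
  "('o, 'a, 'm) category_scheme \<Rightarrow> 'o \<Rightarrow> (('o \<times> 'a) \<times> ('o \<times> 'a)) set" where
  "subobj_rel C S = {((J, i), (K, k)). (J, i) \<in> monos_into C S \<and> (K, k) \<in> monos_into C S \<and>
     (\<exists>h \<in> Hom C J K. is_iso C h \<and> k \<cdot>\<^bsub>C\<^esub> h = i)}"

definition subobj :: "('o, 'a, 'm) category_scheme \<Rightarrow> 'o \<Rightarrow> 'o \<times> 'a \<Rightarrow> ('o \<times> 'a) set" where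
  "subobj C S p = subobj_rel C S `` {p}"

definition subobjects :: "('o, 'a, 'm) category_scheme \<Rightarrow> 'o \<Rightarrow> ('o \<times> 'a) set set" where
  "subobjects C S = monos_into C S // subobj_rel C S"


section \<open>Monoidal categories\<close>

text \<open>\<open>\<otimes>\<^sub>o\<close> and \<open>\<otimes>\<^sub>a\<close> are the tensor product on objects and on arrows; \<open>Assoc\<close>, \<open>LUnit\<close> and \<open>RUnit\<close>
  are the structure isomorphisms
  \<open>(X \<otimes> Y) \<otimes> Z \<rightarrow> X \<otimes> (Y \<otimes> Z)\<close>, \<open>I \<otimes> X \<rightarrow> X\<close> and \<open>X \<otimes> I \<rightarrow> X\<close>. Strictness is not assumed.\<close>

record ('o, 'a) monoidal_category = "('o, 'a) category" +
  TensorO :: "'o \<Rightarrow> 'o \<Rightarrow> 'o"  (infixl "\<otimes>\<^sub>o\<index>" 75)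
  TensorA :: "'a \<Rightarrow> 'a \<Rightarrow> 'a"  (infixl "\<otimes>\<^sub>a\<index>" 75)
  UnitO :: "'o"
  Assoc :: "'o \<Rightarrow> 'o \<Rightarrow> 'o \<Rightarrow> 'a"
  LUnit :: "'o \<Rightarrow> 'a"
  RUnit :: "'o \<Rightarrow> 'a"

locale monoidal_category = category V
  for V :: "('o, 'a, 'm) monoidal_category_scheme" (structure) +
  assumes unit_obj: "UnitO V \<in> Obj V"
    and tensor_obj: "\<lbrakk>X \<in> Obj V; Y \<in> Obj V\<rbrakk> \<Longrightarrow> X \<otimes>\<^sub>o Y \<in> Obj V"
    and tensor_hom:
      "\<lbrakk>f \<in> Hom V X X'; g \<in> Hom V Y Y'\<rbrakk> \<Longrightarrow> f \<otimes>\<^sub>a g \<in> Hom V (X \<otimes>\<^sub>o Y) (X' \<otimes>\<^sub>o Y')"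
    and tensor_ident:
      "\<lbrakk>X \<in> Obj V; Y \<in> Obj V\<rbrakk> \<Longrightarrow> Ident V X \<otimes>\<^sub>a Ident V Y = Ident V (X \<otimes>\<^sub>o Y)"
    and tensor_comp:
      "\<lbrakk>f \<in> Hom V X X'; f' \<in> Hom V X' X''; g \<in> Hom V Y Y'; g' \<in> Hom V Y' Y''\<rbrakk>
        \<Longrightarrow> (f' \<cdot> f) \<otimes>\<^sub>a (g' \<cdot> g) = (f' \<otimes>\<^sub>a g') \<cdot> (f \<otimes>\<^sub>a g)"
    and assoc_hom:
      "\<lbrakk>X \<in> Obj V; Y \<in> Obj V; Z \<in> Obj V\<rbrakk>
        \<Longrightarrow> Assoc V X Y Z \<in> Hom V ((X \<otimes>\<^sub>o Y) \<otimes>\<^sub>o Z) (X \<otimes>\<^sub>o (Y \<otimes>\<^sub>o Z))"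
    and assoc_iso: "\<lbrakk>X \<in> Obj V; Y \<in> Obj V; Z \<in> Obj V\<rbrakk> \<Longrightarrow> is_iso V (Assoc V X Y Z)"
    and assoc_natural:
      "\<lbrakk>f \<in> Hom V X X'; g \<in> Hom V Y Y'; h \<in> Hom V Z Z'\<rbrakk>
        \<Longrightarrow> Assoc V X' Y' Z' \<cdot> ((f \<otimes>\<^sub>a g) \<otimes>\<^sub>a h) = (f \<otimes>\<^sub>a (g \<otimes>\<^sub>a h)) \<cdot> Assoc V X Y Z"
    and lunit_hom: "X \<in> Obj V \<Longrightarrow> LUnit V X \<in> Hom V (UnitO V \<otimes>\<^sub>o X) X"
    and lunit_iso: "X \<in> Obj V \<Longrightarrow> is_iso V (LUnit V X)"
    and lunit_natural:
      "f \<in> Hom V X X' \<Longrightarrow> LUnit V X' \<cdot> (Ident V (UnitO V) \<otimes>\<^sub>a f) = f \<cdot> LUnit V X"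
    and runit_hom: "X \<in> Obj V \<Longrightarrow> RUnit V X \<in> Hom V (X \<otimes>\<^sub>o UnitO V) X"
    and runit_iso: "X \<in> Obj V \<Longrightarrow> is_iso V (RUnit V X)"
    and runit_natural:
      "f \<in> Hom V X X' \<Longrightarrow> RUnit V X' \<cdot> (f \<otimes>\<^sub>a Ident V (UnitO V)) = f \<cdot> RUnit V X"
    and pentagon:
      "\<lbrakk>W \<in> Obj V; X \<in> Obj V; Y \<in> Obj V; Z \<in> Obj V\<rbrakk>
        \<Longrightarrow> (Ident V W \<otimes>\<^sub>a Assoc V X Y Z) \<cdot> Assoc V W (X \<otimes>\<^sub>o Y) Z \<cdot> (Assoc V W X Y \<otimes>\<^sub>a Ident V Z)
            = Assoc V W X (Y \<otimes>\<^sub>o Z) \<cdot> Assoc V (W \<otimes>\<^sub>o X) Y Z"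
    and triangle:
      "\<lbrakk>X \<in> Obj V; Y \<in> Obj V\<rbrakk>
        \<Longrightarrow> (Ident V X \<otimes>\<^sub>a LUnit V Y) \<cdot> Assoc V X (UnitO V) Y = RUnit V X \<otimes>\<^sub>a Ident V Y"


section \<open>Strong monoidal functors and equivalences\<close>

text \<open>\<open>Str F X Y : F X \<otimes>' F Y \<rightarrow> F (X \<otimes> Y)\<close> and \<open>Str0 F : I' \<rightarrow> F I\<close>.\<close>

record ('o, 'a, 'p, 'b) mon_functor =
  MapO :: "'o \<Rightarrow> 'p"
  MapA :: "'a \<Rightarrow> 'b"
  Str :: "'o \<Rightarrow> 'o \<Rightarrow> 'b"
  Str0 :: "'b"

locale strong_monoidal_functor =
  source: monoidal_category V + target: monoidal_category V'
  for V :: "('o, 'a) monoidal_category"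
    and V' :: "('p, 'b) monoidal_category"
    and F :: "('o, 'a, 'p, 'b) mon_functor" +
  assumes map_obj: "X \<in> Obj V \<Longrightarrow> MapO F X \<in> Obj V'"
    and map_hom: "f \<in> Hom V X Y \<Longrightarrow> MapA F f \<in> Hom V' (MapO F X) (MapO F Y)"
    and map_ident: "X \<in> Obj V \<Longrightarrow> MapA F (Ident V X) = Ident V' (MapO F X)"
    and map_comp:
      "\<lbrakk>f \<in> Hom V X Y; g \<in> Hom V Y Z\<rbrakk> \<Longrightarrow> MapA F (g \<cdot>\<^bsub>V\<^esub> f) = MapA F g \<cdot>\<^bsub>V'\<^esub> MapA F f"
    and str_hom:
      "\<lbrakk>X \<in> Obj V; Y \<in> Obj V\<rbrakk>
        \<Longrightarrow> Str F X Y \<in> Hom V' (MapO F X \<otimes>\<^sub>o\<^bsub>V'\<^esub> MapO F Y) (MapO F (X \<otimes>\<^sub>o\<^bsub>V\<^esub> Y))"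
    and str_iso: "\<lbrakk>X \<in> Obj V; Y \<in> Obj V\<rbrakk> \<Longrightarrow> is_iso V' (Str F X Y)"
    and str_natural:
      "\<lbrakk>f \<in> Hom V X X'; g \<in> Hom V Y Y'\<rbrakk>
        \<Longrightarrow> Str F X' Y' \<cdot>\<^bsub>V'\<^esub> (MapA F f \<otimes>\<^sub>a\<^bsub>V'\<^esub> MapA F g) = MapA F (f \<otimes>\<^sub>a\<^bsub>V\<^esub> g) \<cdot>\<^bsub>V'\<^esub> Str F X Y"
    and str0_hom: "Str0 F \<in> Hom V' (UnitO V') (MapO F (UnitO V))"
    and str0_iso: "is_iso V' (Str0 F)"
    and coherence_assoc:
      "\<lbrakk>X \<in> Obj V; Y \<in> Obj V; Z \<in> Obj V\<rbrakk>
        \<Longrightarrow> MapA F (Assoc V X Y Z) \<cdot>\<^bsub>V'\<^esub> Str F (X \<otimes>\<^sub>o\<^bsub>V\<^esub> Y) Z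
              \<cdot>\<^bsub>V'\<^esub> (Str F X Y \<otimes>\<^sub>a\<^bsub>V'\<^esub> Ident V' (MapO F Z))
            = Str F X (Y \<otimes>\<^sub>o\<^bsub>V\<^esub> Z) \<cdot>\<^bsub>V'\<^esub> (Ident V' (MapO F X) \<otimes>\<^sub>a\<^bsub>V'\<^esub> Str F Y Z)
              \<cdot>\<^bsub>V'\<^esub> Assoc V' (MapO F X) (MapO F Y) (MapO F Z)"
    and coherence_lunit:
      "X \<in> Obj V
        \<Longrightarrow> MapA F (LUnit V X) \<cdot>\<^bsub>V'\<^esub> Str F (UnitO V) X
              \<cdot>\<^bsub>V'\<^esub> (Str0 F \<otimes>\<^sub>a\<^bsub>V'\<^esub> Ident V' (MapO F X))
            = LUnit V' (MapO F X)"
    and coherence_runit: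
      "X \<in> Obj V
        \<Longrightarrow> MapA F (RUnit V X) \<cdot>\<^bsub>V'\<^esub> Str F X (UnitO V)
              \<cdot>\<^bsub>V'\<^esub> (Ident V' (MapO F X) \<otimes>\<^sub>a\<^bsub>V'\<^esub> Str0 F)
            = RUnit V' (MapO F X)"

definition id_mon_functor :: "('o, 'a) monoidal_category \<Rightarrow> ('o, 'a, 'o, 'a) mon_functor" where
  "id_mon_functor V = \<lparr>MapO = (\<lambda>X. X), MapA = (\<lambda>f. f),
     Str = (\<lambda>X Y. Ident V (X \<otimes>\<^sub>o\<^bsub>V\<^esub> Y)), Str0 = Ident V (UnitO V)\<rparr>"

text \<open>The composite \<open>G \<circ> F\<close>; the first argument is the target category of \<open>G\<close>.\<close>

definition comp_mon_functor ::
  "('q, 'c) monoidal_category \<Rightarrow> ('p, 'b, 'q, 'c) mon_functor \<Rightarrow> ('o, 'a, 'p, 'b) mon_functor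
    \<Rightarrow> ('o, 'a, 'q, 'c) mon_functor" where
  "comp_mon_functor W G F = \<lparr>MapO = (\<lambda>X. MapO G (MapO F X)), MapA = (\<lambda>f. MapA G (MapA F f)),
     Str = (\<lambda>X Y. MapA G (Str F X Y) \<cdot>\<^bsub>W\<^esub> Str G (MapO F X) (MapO F Y)),
     Str0 = MapA G (Str0 F) \<cdot>\<^bsub>W\<^esub> Str0 G\<rparr>"

definition monoidal_nat_iso ::
  "('o, 'a) monoidal_category \<Rightarrow> ('p, 'b) monoidal_category
    \<Rightarrow> ('o, 'a, 'p, 'b) mon_functor \<Rightarrow> ('o, 'a, 'p, 'b) mon_functor \<Rightarrow> ('o \<Rightarrow> 'b) \<Rightarrow> bool" where
  "monoidal_nat_iso V V' F G \<alpha> \<longleftrightarrow>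
     (\<forall>X \<in> Obj V. \<alpha> X \<in> Hom V' (MapO F X) (MapO G X) \<and> is_iso V' (\<alpha> X)) \<and>
     (\<forall>X Y. \<forall>f \<in> Hom V X Y. \<alpha> Y \<cdot>\<^bsub>V'\<^esub> MapA F f = MapA G f \<cdot>\<^bsub>V'\<^esub> \<alpha> X) \<and>
     (\<forall>X \<in> Obj V. \<forall>Y \<in> Obj V.
        \<alpha> (X \<otimes>\<^sub>o\<^bsub>V\<^esub> Y) \<cdot>\<^bsub>V'\<^esub> Str F X Y = Str G X Y \<cdot>\<^bsub>V'\<^esub> (\<alpha> X \<otimes>\<^sub>a\<^bsub>V'\<^esub> \<alpha> Y)) \<and>
     \<alpha> (UnitO V) \<cdot>\<^bsub>V'\<^esub> Str0 F = Str0 G"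

definition strong_monoidal_equivalence ::
  "('o, 'a) monoidal_category \<Rightarrow> ('p, 'b) monoidal_category \<Rightarrow> ('o, 'a, 'p, 'b) mon_functor
    \<Rightarrow> bool" where
  "strong_monoidal_equivalence V V' \<Phi> \<longleftrightarrow> strong_monoidal_functor V V' \<Phi> \<and>
     (\<exists>\<Phi>'. strong_monoidal_functor V' V \<Phi>' \<and>
        (\<exists>\<eta>. monoidal_nat_iso V' V' (id_mon_functor V') (comp_mon_functor V' \<Phi> \<Phi>') \<eta>) \<and>
        (\<exists>\<epsilon>. monoidal_nat_iso V V (comp_mon_functor V \<Phi>' \<Phi>) (id_mon_functor V) \<epsilon>))"


section \<open>Monoids in a monoidal category\<close>

record ('o, 'a) monoid_object =
  MObj :: "'o"
  MUnit :: "'a"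
  MMult :: "'a"

locale monoid_object = monoidal_category V
  for V :: "('o, 'a) monoidal_category" (structure)
    and S :: "('o, 'a) monoid_object" +
  assumes mobj_obj: "MObj S \<in> Obj V"
    and munit_hom: "MUnit S \<in> Hom V (UnitO V) (MObj S)"
    and mmult_hom: "MMult S \<in> Hom V (MObj S \<otimes>\<^sub>o MObj S) (MObj S)"
    and mmult_assoc:
      "MMult S \<cdot> (MMult S \<otimes>\<^sub>a Ident V (MObj S))
        = MMult S \<cdot> (Ident V (MObj S) \<otimes>\<^sub>a MMult S) \<cdot> Assoc V (MObj S) (MObj S) (MObj S)"
    and munit_left: "MMult S \<cdot> (MUnit S \<otimes>\<^sub>a Ident V (MObj S)) = LUnit V (MObj S)"
    and munit_right: "MMult S \<cdot> (Ident V (MObj S) \<otimes>\<^sub>a MUnit S) = RUnit V (MObj S)"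

definition image_monoid_object ::
  "('p, 'b) monoidal_category \<Rightarrow> ('o, 'a, 'p, 'b) mon_functor \<Rightarrow> ('o, 'a) monoid_object
    \<Rightarrow> ('p, 'b) monoid_object" where
  "image_monoid_object V' \<Phi> S = \<lparr>MObj = MapO \<Phi> (MObj S),
     MUnit = MapA \<Phi> (MUnit S) \<cdot>\<^bsub>V'\<^esub> Str0 \<Phi>,
     MMult = MapA \<Phi> (MMult S) \<cdot>\<^bsub>V'\<^esub> Str \<Phi> (MObj S) (MObj S)\<rparr>"

definition right_pure :: "('o, 'a) monoidal_category \<Rightarrow> 'a \<Rightarrow> bool" where
  "right_pure V f \<longleftrightarrow> (\<forall>Z \<in> Obj V. is_mono V (f \<otimes>\<^sub>a\<^bsub>V\<^esub> Ident V Z))"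


section \<open>Left invertible subobjects\<close>

definition Il :: "('o, 'a) monoidal_category \<Rightarrow> ('o, 'a) monoid_object \<Rightarrow> ('o \<times> 'a) set set" where
  "Il V S = {c \<in> subobjects V (MObj S).
     \<exists>(J, i) \<in> c. is_iso V (MMult S \<cdot>\<^bsub>V\<^esub> (Ident V (MObj S) \<otimes>\<^sub>a\<^bsub>V\<^esub> i))}"

text \<open>Operations on subobjects are lifted from representatives by taking the union over all
  representatives (as in \<^theory>\<open>HOL.Equiv_Relations\<close>): if the operation on representatives respects
  the equivalence, this union is the single class of the result. Note that \<open>subobj C S (J, i)\<close> is
  empty, hence not a subobject, if \<open>i\<close> is not a monomorphism \<open>J \<rightarrow> S\<close>.\<close>

definition Il_mult ::
  "('o, 'a) monoidal_category \<Rightarrow> ('o, 'a) monoid_object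
    \<Rightarrow> ('o \<times> 'a) set \<Rightarrow> ('o \<times> 'a) set \<Rightarrow> ('o \<times> 'a) set" where
  "Il_mult V S c d = (\<Union>(J, i) \<in> c. \<Union>(K, k) \<in> d.
     subobj V (MObj S) (J \<otimes>\<^sub>o\<^bsub>V\<^esub> K, MMult S \<cdot>\<^bsub>V\<^esub> (i \<otimes>\<^sub>a\<^bsub>V\<^esub> k)))"

definition Il_monoid ::
  "('o, 'a) monoidal_category \<Rightarrow> ('o, 'a) monoid_object \<Rightarrow> ('o \<times> 'a) set monoid" where
  "Il_monoid V S = \<lparr>carrier = Il V S, mult = Il_mult V S,
     one = subobj V (MObj S) (UnitO V, MUnit S)\<rparr>"

definition subobj_map ::
  "('p, 'b) monoidal_category \<Rightarrow> ('o, 'a, 'p, 'b) mon_functor \<Rightarrow> ('o, 'a) monoid_object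
    \<Rightarrow> ('o \<times> 'a) set \<Rightarrow> ('p \<times> 'b) set" where
  "subobj_map V' \<Phi> S c = (\<Union>(J, i) \<in> c. subobj V' (MapO \<Phi> (MObj S)) (MapO \<Phi> J, MapA \<Phi> i))"

end

theory Submission
  imports Defs
begin

text \<open>Write \<open>a(i) = m \<cdot> (S \<otimes> i)\<close> for the arrow \<open>S \<otimes> J \<rightarrow> S\<close> attached to \<open>i : J \<rightarrow> S\<close>. The statement
  says that invertibility of \<open>a(i)\<close> and the product \<open>m \<cdot> (i \<otimes> k)\<close> are seen equally well in the
  two categories.

  Being an equivalence, \<open>\<phi>\<close> is faithful, full and essentially surjective
  (\<open>strong_monoidal_equivalence_imp_weak\<close>). Hence \<open>\<phi>\<close> preserves and reflects
  isomorphisms, monomorphisms and equality of subobjects, and every subobject of \<open>\<phi>(S)\<close> is the class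
  of some \<open>\<phi>(i)\<close>. By naturality of the structure isomorphism \<open>\<phi>(J) \<otimes> \<phi>(K) \<rightarrow> \<phi>(J \<otimes> K)\<close>, the product of
  \<open>\<phi>(i)\<close> and \<open>\<phi>(k)\<close> formed in \<open>\<phi>(S)\<close> is \<open>\<phi>(m \<cdot> (i \<otimes> k))\<close> precomposed with that isomorphism
  (\<open>image_product\<close>). Taking the identity of \<open>S\<close> for \<open>i\<close> shows that left invertibility is preserved and
  reflected, which gives the bijection; in general the same equation shows that the bijection is
  multiplicative, and \<open>\<phi>\<^sub>0\<close> identifies the units.

  For the monoid structure, the question is why a product of two left invertible subobjects is
  again given by a monomorphism. If \<open>a(i)\<close> is invertible and \<open>e\<close> is right pure, then \<open>i\<close> is itself
  right pure, because \<open>i\<close> is \<open>e \<otimes> J\<close> followed by \<open>a(i)\<close>, up to the unit isomorphism of \<open>J\<close>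
  (\<open>right_pure_of_action_iso\<close>). So \<open>i \<otimes> K\<close> is a monomorphism, and \<open>m \<cdot> (i \<otimes> k)\<close> is this arrow followed
  by the invertible \<open>a(k)\<close>. The monoid laws then come from those of \<open>S\<close>, with the associativity and
  unit isomorphisms identifying the representatives.

  The monoid of left invertible subobjects of \<open>\<phi>(S)\<close> inherits its laws along the bijection, as the
  image of a monoid under a multiplicative map.\<close>

section \<open>Isomorphisms and monomorphisms\<close>

context category
begin

lemma hom_objD: "f \<in> Hom C X Y \<Longrightarrow> X \<in> Obj C \<and> Y \<in> Obj C"
  using dom_obj cod_obj by (auto simp: Hom_def)

lemma is_iso_iff:
  assumes "f \<in> Hom C X Y"
  shows "is_iso C f \<longleftrightarrow> (\<exists>g \<in> Hom C Y X. g \<cdot> f = Ident C X \<and> f \<cdot> g = Ident C Y)"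
  using assms by (auto simp: is_iso_def Hom_def)

lemma isoE:
  assumes "is_iso C f" and "f \<in> Hom C X Y"
  obtains g where "g \<in> Hom C Y X" and "g \<cdot> f = Ident C X" and "f \<cdot> g = Ident C Y"
    and "is_iso C g"
  using assms is_iso_iff[OF assms(2)] is_iso_iff by metis

lemma is_mono_iff:
  assumes "f \<in> Hom C X Y"
  shows "is_mono C f \<longleftrightarrow>
    (\<forall>W. \<forall>g \<in> Hom C W X. \<forall>h \<in> Hom C W X. f \<cdot> g = f \<cdot> h \<longrightarrow> g = h)"
  using assms by (auto simp: is_mono_def Hom_def)

lemma iso_ident: "X \<in> Obj C \<Longrightarrow> is_iso C (Ident C X)"
  using is_iso_iff[OF ident_hom] ident_hom ident_left by blast

lemma comp_inverse_cancel:
  assumes "f \<in> Hom C X Y" and "g \<in> Hom C Y X" and "g \<cdot> f = Ident C X"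
  shows "h \<in> Hom C W X \<Longrightarrow> g \<cdot> (f \<cdot> h) = h"
    and "k \<in> Hom C X Z \<Longrightarrow> (k \<cdot> g) \<cdot> f = k"
proof -
  assume h: "h \<in> Hom C W X"
  show "g \<cdot> (f \<cdot> h) = h"
    using comp_assoc[OF h assms(1,2)] assms(3) ident_left[OF h] by simp
next
  assume k: "k \<in> Hom C X Z"
  show "(k \<cdot> g) \<cdot> f = k"
    using comp_assoc[OF assms(1,2) k] assms(3) ident_right[OF k] by simp
qed

lemma iso_comp:
  assumes f: "f \<in> Hom C X Y" "is_iso C f" and g: "g \<in> Hom C Y Z" "is_iso C g"
  shows "is_iso C (g \<cdot> f)"
proof -
  obtain f' where f': "f' \<in> Hom C Y X" "f' \<cdot> f = Ident C X" "f \<cdot> f' = Ident C Y"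
    using isoE f by blast
  obtain g' where g': "g' \<in> Hom C Z Y" "g' \<cdot> g = Ident C Y" "g \<cdot> g' = Ident C Z"
    using isoE g by blast
  have "(f' \<cdot> g') \<cdot> (g \<cdot> f) = Ident C X"
    using comp_assoc[OF comp_hom[OF f(1) g(1)] g'(1) f'(1)]
      comp_inverse_cancel(1)[OF g(1) g'(1,2) f(1)] f'(2) by simp
  moreover have "(g \<cdot> f) \<cdot> (f' \<cdot> g') = Ident C Z"
    using comp_assoc[OF comp_hom[OF g'(1) f'(1)] f(1) g(1)]
      comp_inverse_cancel(1)[OF f'(1) f(1) f'(3) g'(1)] g'(3) by simp
  ultimately show ?thesis
    using is_iso_iff[OF comp_hom[OF f(1) g(1)]] comp_hom[OF g'(1) f'(1)] by blast
qed

lemma iso_comp_right_iff: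
  assumes f: "f \<in> Hom C X Y" "is_iso C f" and g: "g \<in> Hom C Y Z"
  shows "is_iso C (g \<cdot> f) \<longleftrightarrow> is_iso C g"
proof
  assume gf: "is_iso C (g \<cdot> f)"
  obtain f' where f': "f' \<in> Hom C Y X" "f \<cdot> f' = Ident C Y" "is_iso C f'"
    using isoE f by blast
  have "(g \<cdot> f) \<cdot> f' = g"
    by (rule comp_inverse_cancel(2)[OF f'(1) f(1) f'(2) g])
  then show "is_iso C g"
    using iso_comp[OF f'(1,3) comp_hom[OF f(1) g] gf] by simp
qed (rule iso_comp[OF f g])

lemma iso_mono:
  assumes f: "f \<in> Hom C X Y" "is_iso C f"
  shows "is_mono C f"
proof -
  obtain f' where f': "f' \<in> Hom C Y X" "f' \<cdot> f = Ident C X"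
    using isoE f by blast
  show ?thesis
    unfolding is_mono_iff[OF f(1)] using comp_inverse_cancel(1)[OF f(1) f'] by metis
qed

lemma iso_epi:
  assumes f: "f \<in> Hom C X Y" "is_iso C f" and g: "g \<in> Hom C Y Z" and h: "h \<in> Hom C Y Z"
    and eq: "g \<cdot> f = h \<cdot> f"
  shows "g = h"
proof -
  obtain f' where f': "f' \<in> Hom C Y X" "f \<cdot> f' = Ident C Y"
    using isoE f by blast
  show ?thesis
    using comp_inverse_cancel(2)[OF f'(1) f(1) f'(2)] g h eq by metis
qed

lemma mono_comp:
  assumes f: "f \<in> Hom C X Y" "is_mono C f" and g: "g \<in> Hom C Y Z" "is_mono C g"
  shows "is_mono C (g \<cdot> f)"
  unfolding is_mono_iff[OF comp_hom[OF f(1) g(1)]]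
proof (intro allI ballI impI)
  fix W h k
  assume h: "h \<in> Hom C W X" and k: "k \<in> Hom C W X" and eq: "(g \<cdot> f) \<cdot> h = (g \<cdot> f) \<cdot> k"
  have "g \<cdot> (f \<cdot> h) = g \<cdot> (f \<cdot> k)"
    using eq comp_assoc[OF h f(1) g(1)] comp_assoc[OF k f(1) g(1)] by simp
  then have "f \<cdot> h = f \<cdot> k"
    using g(2) comp_hom[OF h f(1)] comp_hom[OF k f(1)] unfolding is_mono_iff[OF g(1)] by blast
  then show "h = k"
    using f(2) h k unfolding is_mono_iff[OF f(1)] by blast
qed

lemma mono_of_comp:
  assumes f: "f \<in> Hom C X Y" and g: "g \<in> Hom C Y Z" and gf: "is_mono C (g \<cdot> f)"
  shows "is_mono C f"
  unfolding is_mono_iff[OF f]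
proof (intro allI ballI impI)
  fix W h k
  assume h: "h \<in> Hom C W X" and k: "k \<in> Hom C W X" and eq: "f \<cdot> h = f \<cdot> k"
  have "(g \<cdot> f) \<cdot> h = (g \<cdot> f) \<cdot> k"
    using eq comp_assoc[OF h f(1) g(1)] comp_assoc[OF k f(1) g(1)] by simp
  then show "h = k"
    using gf h k unfolding is_mono_iff[OF comp_hom[OF f g]] by blast
qed

lemma mono_comp_right_iff:
  assumes f: "f \<in> Hom C X Y" "is_iso C f" and g: "g \<in> Hom C Y Z"
  shows "is_mono C (g \<cdot> f) \<longleftrightarrow> is_mono C g"
proof
  assume gf: "is_mono C (g \<cdot> f)"
  obtain f' where f': "f' \<in> Hom C Y X" "f \<cdot> f' = Ident C Y" "is_iso C f'"
    using isoE f by blast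
  have "(g \<cdot> f) \<cdot> f' = g"
    by (rule comp_inverse_cancel(2)[OF f'(1) f(1) f'(2) g])
  then show "is_mono C g"
    using mono_comp[OF f'(1) iso_mono[OF f'(1,3)] comp_hom[OF f(1) g] gf] by simp
qed (rule mono_comp[OF f(1) iso_mono[OF f] g])


section \<open>Subobjects as equivalence classes\<close>

lemma monos_into_iff: "(J, i) \<in> monos_into C S \<longleftrightarrow> i \<in> Hom C J S \<and> is_mono C i"
  by (simp add: monos_into_def)

text \<open>That \<open>i\<close> is a monomorphism comes from \<open>k\<close> being one and \<open>h\<close> an isomorphism.\<close>

lemma subobj_relI:
  assumes h: "h \<in> Hom C J K" "is_iso C h" and k: "(K, k) \<in> monos_into C S"
    and eq: "k \<cdot> h = i"
  shows "((J, i), (K, k)) \<in> subobj_rel C S"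
proof -
  have "k \<in> Hom C K S" and "is_mono C k"
    using k by (auto simp: monos_into_iff)
  then have "(J, i) \<in> monos_into C S"
    using comp_hom[OF h(1)] mono_comp_right_iff[OF h] eq by (auto simp: monos_into_iff)
  then show ?thesis
    using assms by (auto simp: subobj_rel_def)
qed

lemma subobj_relE:
  assumes "((J, i), (K, k)) \<in> subobj_rel C S"
  obtains h where "h \<in> Hom C J K" and "is_iso C h" and "k \<cdot> h = i"
    and "i \<in> Hom C J S" and "is_mono C i" and "k \<in> Hom C K S" and "is_mono C k"
  using assms by (auto simp: subobj_rel_def monos_into_iff)

lemma equiv_subobj_rel: "equiv (monos_into C S) (subobj_rel C S)"
proof (rule equivI)
  show "subobj_rel C S \<subseteq> monos_into C S \<times> monos_into C S"
    by (auto simp: subobj_rel_def)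
  show "refl_on (monos_into C S) (subobj_rel C S)"
  proof (rule refl_onI)
    fix p assume p: "p \<in> monos_into C S"
    obtain J i where p_eq: "p = (J, i)" by (cases p)
    have i: "i \<in> Hom C J S" using p p_eq by (simp add: monos_into_iff)
    have J: "J \<in> Obj C" using hom_objD[OF i] by blast
    show "(p, p) \<in> subobj_rel C S"
      using subobj_relI[OF ident_hom[OF J] iso_ident[OF J]] p ident_right[OF i] p_eq by blast
  qed
  show "sym (subobj_rel C S)"
  proof (rule symI)
    fix p q assume pq: "(p, q) \<in> subobj_rel C S"
    obtain J i K k where eqs: "p = (J, i)" "q = (K, k)" by (cases p, cases q)
    obtain h where h: "h \<in> Hom C J K" "is_iso C h" "k \<cdot> h = i"
      and k: "k \<in> Hom C K S" and i: "i \<in> Hom C J S" "is_mono C i"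
      using subobj_relE pq eqs by metis
    obtain h' where h': "h' \<in> Hom C K J" "h \<cdot> h' = Ident C K" "is_iso C h'"
      using isoE h by blast
    have "i \<cdot> h' = k"
      using comp_inverse_cancel(2)[OF h'(1) h(1) h'(2) k] h(3) by simp
    then show "(q, p) \<in> subobj_rel C S"
      using subobj_relI[OF h'(1,3)] i eqs by (simp add: monos_into_iff)
  qed
  show "trans (subobj_rel C S)"
  proof (rule transI)
    fix p q r assume pq: "(p, q) \<in> subobj_rel C S" and qr: "(q, r) \<in> subobj_rel C S"
    obtain J i K k L l where eqs: "p = (J, i)" "q = (K, k)" "r = (L, l)"
      by (cases p, cases q, cases r)
    obtain h where h: "h \<in> Hom C J K" "is_iso C h" "k \<cdot> h = i"
      using subobj_relE pq eqs by metis
    obtain g where g: "g \<in> Hom C K L" "is_iso C g" "l \<cdot> g = k"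
      and l: "l \<in> Hom C L S" "is_mono C l"
      using subobj_relE qr eqs by metis
    have "l \<cdot> (g \<cdot> h) = i"
      using comp_assoc[OF h(1) g(1) l(1)] g(3) h(3) by simp
    then show "(p, r) \<in> subobj_rel C S"
      using subobj_relI[OF comp_hom[OF h(1) g(1)] iso_comp[OF h(1,2) g(1,2)]] l eqs
      by (simp add: monos_into_iff)
  qed
qed

lemma subobj_eq_iff:
  assumes "p \<in> monos_into C S" and "q \<in> monos_into C S"
  shows "subobj C S p = subobj C S q \<longleftrightarrow> (p, q) \<in> subobj_rel C S"
  unfolding subobj_def using eq_equiv_class_iff[OF equiv_subobj_rel assms] .

lemma subobj_eqI:
  assumes "h \<in> Hom C J K" and "is_iso C h" and "(K, k) \<in> monos_into C S" and "k \<cdot> h = i"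
  shows "subobj C S (J, i) = subobj C S (K, k)"
  unfolding subobj_def by (rule equiv_class_eq[OF equiv_subobj_rel subobj_relI[OF assms]])

lemma subobj_self: "p \<in> monos_into C S \<Longrightarrow> p \<in> subobj C S p"
  unfolding subobj_def by (rule equiv_class_self[OF equiv_subobj_rel])

lemma subobj_in_subobjects: "p \<in> monos_into C S \<Longrightarrow> subobj C S p \<in> subobjects C S"
  by (auto simp: subobjects_def subobj_def intro: quotientI)

lemma subobjectsE:
  assumes "c \<in> subobjects C S"
  obtains J i where "(J, i) \<in> monos_into C S" and "c = subobj C S (J, i)"
  using assms by (auto simp: subobjects_def subobj_def elim!: quotientE)

end


section \<open>Left invertible subobjects\<close>

context monoidal_category
begin

lemma tensor_iso:
  assumes f: "f \<in> Hom V X X'" "is_iso V f" and g: "g \<in> Hom V Y Y'" "is_iso V g"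
  shows "is_iso V (f \<otimes>\<^sub>a g)"
proof -
  obtain f' where f': "f' \<in> Hom V X' X" "f' \<cdot> f = Ident V X" "f \<cdot> f' = Ident V X'"
    using isoE f by blast
  obtain g' where g': "g' \<in> Hom V Y' Y" "g' \<cdot> g = Ident V Y" "g \<cdot> g' = Ident V Y'"
    using isoE g by blast
  have obj: "X \<in> Obj V" "Y \<in> Obj V" "X' \<in> Obj V" "Y' \<in> Obj V"
    using hom_objD[OF f(1)] hom_objD[OF g(1)] by auto
  have "(f' \<otimes>\<^sub>a g') \<cdot> (f \<otimes>\<^sub>a g) = Ident V (X \<otimes>\<^sub>o Y)"
    using tensor_comp[OF f(1) f'(1) g(1) g'(1)] f' g' tensor_ident obj by simp
  moreover have "(f \<otimes>\<^sub>a g) \<cdot> (f' \<otimes>\<^sub>a g') = Ident V (X' \<otimes>\<^sub>o Y')"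
    using tensor_comp[OF f'(1) f(1) g'(1) g(1)] f' g' tensor_ident obj by simp
  ultimately show ?thesis
    using is_iso_iff[OF tensor_hom[OF f(1) g(1)]] tensor_hom[OF f'(1) g'(1)] by blast
qed

end

text \<open>The common ground of \<open>S\<close> and \<open>\<phi>(S)\<close>: membership in \<open>Il\<close> and the formula for the product of two
  classes depend on the multiplication alone, and here they are proved for both at once.\<close>

locale magma_object = monoidal_category V
  for V :: "('o, 'a) monoidal_category" (structure)
    and S :: "('o, 'a) monoid_object" +
  assumes magma_obj: "MObj S \<in> Obj V"
    and magma_mult_hom: "MMult S \<in> Hom V (MObj S \<otimes>\<^sub>o MObj S) (MObj S)"
begin

abbreviation product :: "'a \<Rightarrow> 'a \<Rightarrow> 'a" where
  "product i k \<equiv> MMult S \<cdot> (i \<otimes>\<^sub>a k)"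

abbreviation action :: "'a \<Rightarrow> 'a" where
  "action i \<equiv> product (Ident V (MObj S)) i"

lemma product_hom:
  "\<lbrakk>i \<in> Hom V J (MObj S); k \<in> Hom V K (MObj S)\<rbrakk> \<Longrightarrow> product i k \<in> Hom V (J \<otimes>\<^sub>o K) (MObj S)"
  using comp_hom tensor_hom magma_mult_hom by blast

lemma product_comp:
  assumes i: "i \<in> Hom V J (MObj S)" and k: "k \<in> Hom V K (MObj S)"
    and h: "h \<in> Hom V J' J" and h': "h' \<in> Hom V K' K"
  shows "product (i \<cdot> h) (k \<cdot> h') = product i k \<cdot> (h \<otimes>\<^sub>a h')"
  using tensor_comp[OF h i h' k] comp_assoc[OF tensor_hom[OF h h'] tensor_hom[OF i k] magma_mult_hom]
  by simp

lemma action_hom: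
  "i \<in> Hom V J (MObj S) \<Longrightarrow> action i \<in> Hom V (MObj S \<otimes>\<^sub>o J) (MObj S)"
  using product_hom ident_hom magma_obj by blast

lemma action_comp:
  assumes k: "k \<in> Hom V K (MObj S)" and h: "h \<in> Hom V J K"
  shows "action (k \<cdot> h) = action k \<cdot> (Ident V (MObj S) \<otimes>\<^sub>a h)"
  using product_comp[OF ident_hom[OF magma_obj] k ident_hom[OF magma_obj] h]
    ident_left[OF ident_hom[OF magma_obj]] by simp

text \<open>The product as an arrow followed by the action of the second factor. When that action is
  invertible, properties of the product reduce to properties of \<open>i \<otimes> K\<close>.\<close>

lemma product_eq_action:
  assumes i: "i \<in> Hom V J (MObj S)" and k: "k \<in> Hom V K (MObj S)"
  shows "product i k = action k \<cdot> (i \<otimes>\<^sub>a Ident V K)"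
proof -
  have K: "K \<in> Obj V" using hom_objD[OF k] by blast
  show ?thesis
    using product_comp[OF ident_hom[OF magma_obj] k i ident_hom[OF K]] ident_left[OF i]
      ident_right[OF k] by simp
qed

text \<open>Two representatives differ by an isomorphism \<open>h\<close>, and their actions by \<open>S \<otimes> h\<close>, so invertibility
  of the action can be tested on any representative.\<close>

lemma subobj_in_Il_iff:
  assumes Ji: "(J, i) \<in> monos_into V (MObj S)"
  shows "subobj V (MObj S) (J, i) \<in> Il V S \<longleftrightarrow> is_iso V (action i)"
proof
  assume "subobj V (MObj S) (J, i) \<in> Il V S"
  then obtain K k where Kk: "(K, k) \<in> subobj V (MObj S) (J, i)" and ak: "is_iso V (action k)"
    by (auto simp: Il_def)
  then have "((J, i), (K, k)) \<in> subobj_rel V (MObj S)"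
    by (simp add: subobj_def)
  then obtain h where h: "h \<in> Hom V J K" "is_iso V h" "k \<cdot> h = i" and k: "k \<in> Hom V K (MObj S)"
    using subobj_relE by metis
  have "is_iso V (Ident V (MObj S) \<otimes>\<^sub>a h)"
    using tensor_iso ident_hom iso_ident magma_obj h by blast
  then have "is_iso V (action k \<cdot> (Ident V (MObj S) \<otimes>\<^sub>a h))"
    using iso_comp tensor_hom ident_hom magma_obj h(1) action_hom[OF k] ak by blast
  then show "is_iso V (action i)"
    using action_comp[OF k h(1)] h(3) by simp
next
  assume "is_iso V (action i)"
  then show "subobj V (MObj S) (J, i) \<in> Il V S"
    using subobj_in_subobjects[OF Ji] subobj_self[OF Ji] by (auto simp: Il_def)
qed

lemma IlE:
  assumes "c \<in> Il V S"
  obtains J i where "(J, i) \<in> monos_into V (MObj S)" and "c = subobj V (MObj S) (J, i)"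
    and "i \<in> Hom V J (MObj S)" and "is_iso V (action i)"
proof -
  have "c \<in> subobjects V (MObj S)" using assms by (simp add: Il_def)
  then obtain J i where Ji: "(J, i) \<in> monos_into V (MObj S)" and c: "c = subobj V (MObj S) (J, i)"
    using subobjectsE by blast
  then show ?thesis
    using that[OF Ji c] assms subobj_in_Il_iff[OF Ji] Ji by (simp add: monos_into_iff)
qed

text \<open>Replacing \<open>i\<close> and \<open>k\<close> by \<open>i \<cdot> f\<close> and \<open>k \<cdot> g\<close> precomposes the product with the isomorphism \<open>f \<otimes> g\<close>.
  So all products of representatives are monomorphisms as soon as one is, and the union defining
  the product of the classes has equal members.\<close>

lemma Il_mult_subobj:
  assumes i: "(J, i) \<in> monos_into V (MObj S)" and k: "(K, k) \<in> monos_into V (MObj S)"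
    and mono: "is_mono V (product i k)"
  shows "Il_mult V S (subobj V (MObj S) (J, i)) (subobj V (MObj S) (K, k))
    = subobj V (MObj S) (J \<otimes>\<^sub>o K, product i k)"
proof -
  let ?c = "subobj V (MObj S) (J, i)" and ?d = "subobj V (MObj S) (K, k)"
  have prod: "subobj V (MObj S) (J' \<otimes>\<^sub>o K', product i' k') = subobj V (MObj S) (J \<otimes>\<^sub>o K, product i k)"
    if J': "(J', i') \<in> ?c" and K': "(K', k') \<in> ?d" for J' i' K' k'
  proof -
    have "((J', i'), (J, i)) \<in> subobj_rel V (MObj S)"
      using J' equiv_subobj_rel unfolding subobj_def by (meson Image_singleton_iff equivE symD)
    then obtain f where f: "f \<in> Hom V J' J" "is_iso V f" "i \<cdot> f = i'" and ih: "i \<in> Hom V J (MObj S)"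
      using subobj_relE by metis
    have "((K', k'), (K, k)) \<in> subobj_rel V (MObj S)"
      using K' equiv_subobj_rel unfolding subobj_def by (meson Image_singleton_iff equivE symD)
    then obtain g where g: "g \<in> Hom V K' K" "is_iso V g" "k \<cdot> g = k'" and kh: "k \<in> Hom V K (MObj S)"
      using subobj_relE by metis
    have "(J \<otimes>\<^sub>o K, product i k) \<in> monos_into V (MObj S)"
      using product_hom[OF ih kh] mono by (simp add: monos_into_iff)
    moreover have "product i k \<cdot> (f \<otimes>\<^sub>a g) = product i' k'"
      using product_comp[OF ih kh f(1) g(1)] f(3) g(3) by simp
    ultimately show ?thesis
      by (rule subobj_eqI[OF tensor_hom[OF f(1) g(1)] tensor_iso[OF f(1,2) g(1,2)]])
  qed
  have "(J, i) \<in> ?c" and "(K, k) \<in> ?d"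
    using subobj_self i k by auto
  then show ?thesis
    unfolding Il_mult_def using prod by blast
qed

end

sublocale monoid_object \<subseteq> magma_object
  by unfold_locales (rule mobj_obj mmult_hom)+

context monoid_object
begin

lemma unit_product:
  assumes i: "i \<in> Hom V J (MObj S)"
  shows "product (MUnit S) i = i \<cdot> LUnit V J"
proof -
  let ?I = "Ident V (UnitO V)"
  have I: "?I \<in> Hom V (UnitO V) (UnitO V)" using ident_hom unit_obj by blast
  have "product (MUnit S) i = product (MUnit S) (Ident V (MObj S)) \<cdot> (?I \<otimes>\<^sub>a i)"
    using product_comp[OF munit_hom ident_hom[OF mobj_obj] I i] ident_right[OF munit_hom]
      ident_left[OF i] by simp
  then show ?thesis using munit_left lunit_natural[OF i] by simp
qed

lemma product_unit:
  assumes i: "i \<in> Hom V J (MObj S)"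
  shows "product i (MUnit S) = i \<cdot> RUnit V J"
proof -
  let ?I = "Ident V (UnitO V)"
  have I: "?I \<in> Hom V (UnitO V) (UnitO V)" using ident_hom unit_obj by blast
  have "product i (MUnit S) = product (Ident V (MObj S)) (MUnit S) \<cdot> (i \<otimes>\<^sub>a ?I)"
    using product_comp[OF ident_hom[OF mobj_obj] munit_hom i I] ident_right[OF munit_hom]
      ident_left[OF i] by simp
  then show ?thesis using munit_right runit_natural[OF i] by simp
qed

lemma product_assoc:
  assumes i: "i \<in> Hom V J (MObj S)" and k: "k \<in> Hom V K (MObj S)" and l: "l \<in> Hom V L (MObj S)"
  shows "product (product i k) l = product i (product k l) \<cdot> Assoc V J K L"
proof -
  let ?S = "MObj S" and ?m = "MMult S" and ?a = "Assoc V (MObj S) (MObj S) (MObj S)"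
  let ?s = "Ident V (MObj S)"
  have s: "?s \<in> Hom V ?S ?S" using ident_hom mobj_obj by blast
  have obj: "J \<in> Obj V" "K \<in> Obj V" "L \<in> Obj V" using hom_objD i k l by blast+
  have a: "?a \<in> Hom V ((?S \<otimes>\<^sub>o ?S) \<otimes>\<^sub>o ?S) (?S \<otimes>\<^sub>o (?S \<otimes>\<^sub>o ?S))"
    using assoc_hom mobj_obj by blast
  have b: "Assoc V J K L \<in> Hom V ((J \<otimes>\<^sub>o K) \<otimes>\<^sub>o L) (J \<otimes>\<^sub>o (K \<otimes>\<^sub>o L))"
    using assoc_hom obj by blast
  have sm: "?s \<otimes>\<^sub>a ?m \<in> Hom V (?S \<otimes>\<^sub>o (?S \<otimes>\<^sub>o ?S)) (?S \<otimes>\<^sub>o ?S)"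
    using tensor_hom s mmult_hom by blast
  have ms: "?m \<otimes>\<^sub>a ?s \<in> Hom V ((?S \<otimes>\<^sub>o ?S) \<otimes>\<^sub>o ?S) (?S \<otimes>\<^sub>o ?S)"
    using tensor_hom s mmult_hom by blast
  have t1: "(i \<otimes>\<^sub>a k) \<otimes>\<^sub>a l \<in> Hom V ((J \<otimes>\<^sub>o K) \<otimes>\<^sub>o L) ((?S \<otimes>\<^sub>o ?S) \<otimes>\<^sub>o ?S)"
    using tensor_hom i k l by blast
  have t2: "i \<otimes>\<^sub>a (k \<otimes>\<^sub>a l) \<in> Hom V (J \<otimes>\<^sub>o (K \<otimes>\<^sub>o L)) (?S \<otimes>\<^sub>o (?S \<otimes>\<^sub>o ?S))"
    using tensor_hom i k l by blast
  have msm: "?m \<cdot> (?s \<otimes>\<^sub>a ?m) \<in> Hom V (?S \<otimes>\<^sub>o (?S \<otimes>\<^sub>o ?S)) ?S"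
    using comp_hom[OF sm mmult_hom] .
  have "product (product i k) l = ?m \<cdot> ((?m \<otimes>\<^sub>a ?s) \<cdot> ((i \<otimes>\<^sub>a k) \<otimes>\<^sub>a l))"
    using tensor_comp[OF tensor_hom[OF i k] mmult_hom l s] ident_left[OF l] by simp
  also have "\<dots> = (?m \<cdot> (?m \<otimes>\<^sub>a ?s)) \<cdot> ((i \<otimes>\<^sub>a k) \<otimes>\<^sub>a l)"
    using comp_assoc[OF t1 ms mmult_hom] by simp
  also have "\<dots> = (?m \<cdot> (?s \<otimes>\<^sub>a ?m) \<cdot> ?a) \<cdot> ((i \<otimes>\<^sub>a k) \<otimes>\<^sub>a l)"
    using mmult_assoc by simp
  also have "\<dots> = (?m \<cdot> (?s \<otimes>\<^sub>a ?m)) \<cdot> (?a \<cdot> ((i \<otimes>\<^sub>a k) \<otimes>\<^sub>a l))"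
    using comp_assoc[OF t1 a msm] .
  also have "\<dots> = (?m \<cdot> (?s \<otimes>\<^sub>a ?m)) \<cdot> ((i \<otimes>\<^sub>a (k \<otimes>\<^sub>a l)) \<cdot> Assoc V J K L)"
    using assoc_natural[OF i k l] by simp
  also have "\<dots> = (?m \<cdot> (?s \<otimes>\<^sub>a ?m)) \<cdot> (i \<otimes>\<^sub>a (k \<otimes>\<^sub>a l)) \<cdot> Assoc V J K L"
    using comp_assoc[OF b t2 msm] by simp
  also have "(?m \<cdot> (?s \<otimes>\<^sub>a ?m)) \<cdot> (i \<otimes>\<^sub>a (k \<otimes>\<^sub>a l)) = product i (product k l)"
    using comp_assoc[OF t2 sm mmult_hom] tensor_comp[OF i s tensor_hom[OF k l] mmult_hom]
      ident_left[OF i] by simp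
  finally show ?thesis .
qed

text \<open>By associativity, acting by a product is acting by the factors in turn:
  \<open>a(m \<cdot> (i \<otimes> k))\<close> agrees with \<open>a(k) \<cdot> (a(i) \<otimes> K)\<close> up to the associativity isomorphism.\<close>

lemma action_product_iso:
  assumes i: "i \<in> Hom V J (MObj S)" "is_iso V (action i)"
    and k: "k \<in> Hom V K (MObj S)" "is_iso V (action k)"
  shows "is_iso V (action (product i k))"
proof -
  have s: "Ident V (MObj S) \<in> Hom V (MObj S) (MObj S)" using ident_hom mobj_obj by blast
  have obj: "J \<in> Obj V" "K \<in> Obj V" using hom_objD i k by blast+
  have "is_iso V (action i \<otimes>\<^sub>a Ident V K)"
    using tensor_iso[OF action_hom[OF i(1)] i(2) ident_hom iso_ident] obj by blast
  then have "is_iso V (action k \<cdot> (action i \<otimes>\<^sub>a Ident V K))"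
    using iso_comp[OF tensor_hom[OF action_hom[OF i(1)] ident_hom] _ action_hom[OF k(1)] k(2)] obj
    by blast
  then have "is_iso V (product (action i) k)"
    using product_eq_action[OF action_hom[OF i(1)] k(1)] by simp
  then show ?thesis
    using product_assoc[OF s i(1) k(1)] obj mobj_obj
      iso_comp_right_iff[OF assoc_hom assoc_iso action_hom[OF product_hom[OF i(1) k(1)]]]
    by auto
qed

text \<open>The unit law gives \<open>a(i) \<cdot> (e \<otimes> J) = i \<cdot> l\<close>, where \<open>l : I \<otimes> J \<rightarrow> J\<close> is the unit isomorphism.
  Tensoring with \<open>Z\<close> exhibits \<open>i \<otimes> Z\<close>, up to an isomorphism, as \<open>(e \<otimes> J) \<otimes> Z\<close> followed by an isomorphism;
  and \<open>(e \<otimes> J) \<otimes> Z\<close> is a monomorphism because \<open>e \<otimes> (J \<otimes> Z)\<close> is.\<close>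

lemma right_pure_of_action_iso:
  assumes pure: "right_pure V (MUnit S)"
    and i: "i \<in> Hom V J (MObj S)" "is_iso V (action i)"
  shows "right_pure V i"
  unfolding right_pure_def
proof
  fix Z assume Z: "Z \<in> Obj V"
  let ?e = "MUnit S" and ?j = "Ident V J" and ?z = "Ident V Z"
  have J: "J \<in> Obj V" using hom_objD[OF i(1)] by blast
  have z: "?z \<in> Hom V Z Z" and j: "?j \<in> Hom V J J" using ident_hom Z J by auto
  have ej: "?e \<otimes>\<^sub>a ?j \<in> Hom V (UnitO V \<otimes>\<^sub>o J) (MObj S \<otimes>\<^sub>o J)"
    using tensor_hom[OF munit_hom j] .
  have ejz: "(?e \<otimes>\<^sub>a ?j) \<otimes>\<^sub>a ?z \<in> Hom V ((UnitO V \<otimes>\<^sub>o J) \<otimes>\<^sub>o Z) ((MObj S \<otimes>\<^sub>o J) \<otimes>\<^sub>o Z)"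
    using tensor_hom[OF ej z] .
  have e_jz: "?e \<otimes>\<^sub>a (?j \<otimes>\<^sub>a ?z) \<in> Hom V (UnitO V \<otimes>\<^sub>o (J \<otimes>\<^sub>o Z)) (MObj S \<otimes>\<^sub>o (J \<otimes>\<^sub>o Z))"
    using tensor_hom[OF munit_hom tensor_hom[OF j z]] .
  note a = assoc_hom[OF unit_obj J Z] and a' = assoc_hom[OF mobj_obj J Z]
  have "is_mono V (?e \<otimes>\<^sub>a (?j \<otimes>\<^sub>a ?z))"
    using pure tensor_ident[OF J Z] tensor_obj[OF J Z] by (simp add: right_pure_def)
  then have "is_mono V ((?e \<otimes>\<^sub>a (?j \<otimes>\<^sub>a ?z)) \<cdot> Assoc V (UnitO V) J Z)"
    using mono_comp_right_iff[OF a assoc_iso[OF unit_obj J Z] e_jz] by blast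
  then have "is_mono V (Assoc V (MObj S) J Z \<cdot> ((?e \<otimes>\<^sub>a ?j) \<otimes>\<^sub>a ?z))"
    using assoc_natural[OF munit_hom j z] by simp
  then have mono_ejz: "is_mono V ((?e \<otimes>\<^sub>a ?j) \<otimes>\<^sub>a ?z)"
    using mono_of_comp[OF ejz a'] by blast
  have iz: "action i \<otimes>\<^sub>a ?z \<in> Hom V ((MObj S \<otimes>\<^sub>o J) \<otimes>\<^sub>o Z) (MObj S \<otimes>\<^sub>o Z)"
    using tensor_hom[OF action_hom[OF i(1)] z] .
  have "is_iso V (action i \<otimes>\<^sub>a ?z)"
    using tensor_iso[OF action_hom[OF i(1)] i(2) z iso_ident[OF Z]] .
  then have "is_mono V ((action i \<otimes>\<^sub>a ?z) \<cdot> ((?e \<otimes>\<^sub>a ?j) \<otimes>\<^sub>a ?z))"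
    using mono_comp[OF ejz mono_ejz iz iso_mono[OF iz]] by blast
  also have "(action i \<otimes>\<^sub>a ?z) \<cdot> ((?e \<otimes>\<^sub>a ?j) \<otimes>\<^sub>a ?z) = (action i \<cdot> (?e \<otimes>\<^sub>a ?j)) \<otimes>\<^sub>a ?z"
    using tensor_comp[OF ej action_hom[OF i(1)] z z] ident_left[OF z] by simp
  also have "\<dots> = (i \<cdot> LUnit V J) \<otimes>\<^sub>a ?z"
    using product_eq_action[OF munit_hom i(1)] unit_product[OF i(1)] by simp
  also have "\<dots> = (i \<otimes>\<^sub>a ?z) \<cdot> (LUnit V J \<otimes>\<^sub>a ?z)"
    using tensor_comp[OF lunit_hom[OF J] i(1) z z] ident_left[OF z] by simp
  finally show "is_mono V (i \<otimes>\<^sub>a ?z)"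
    using mono_comp_right_iff[OF tensor_hom[OF lunit_hom[OF J] z]
        tensor_iso[OF lunit_hom[OF J] lunit_iso[OF J] z iso_ident[OF Z]] tensor_hom[OF i(1) z]]
    by simp
qed

lemma product_mono:
  assumes pure: "right_pure V (MUnit S)"
    and i: "i \<in> Hom V J (MObj S)" "is_iso V (action i)"
    and k: "k \<in> Hom V K (MObj S)" "is_iso V (action k)"
  shows "is_mono V (product i k)"
proof -
  have K: "K \<in> Obj V" using hom_objD[OF k(1)] by blast
  have "is_mono V (i \<otimes>\<^sub>a Ident V K)"
    using right_pure_of_action_iso[OF pure i] K by (simp add: right_pure_def)
  then have "is_mono V (action k \<cdot> (i \<otimes>\<^sub>a Ident V K))"
    by (rule mono_comp[OF tensor_hom[OF i(1) ident_hom[OF K]] _ action_hom[OF k(1)]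
          iso_mono[OF action_hom[OF k(1)] k(2)]])
  then show ?thesis using product_eq_action[OF i(1) k(1)] by simp
qed

text \<open>Right purity at \<open>Z = I\<close>, combined with naturality of the right unit isomorphism.\<close>

lemma unit_mono:
  assumes pure: "right_pure V (MUnit S)"
  shows "is_mono V (MUnit S)"
proof -
  have I: "Ident V (UnitO V) \<in> Hom V (UnitO V) (UnitO V)" using ident_hom unit_obj by blast
  have "is_mono V (MUnit S \<otimes>\<^sub>a Ident V (UnitO V))"
    using pure unit_obj by (simp add: right_pure_def)
  then have "is_mono V (RUnit V (MObj S) \<cdot> (MUnit S \<otimes>\<^sub>a Ident V (UnitO V)))"
    using mono_comp[OF tensor_hom[OF munit_hom I] _ runit_hom[OF mobj_obj]
        iso_mono[OF runit_hom[OF mobj_obj] runit_iso[OF mobj_obj]]] by blast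
  then show ?thesis
    using runit_natural[OF munit_hom]
      mono_comp_right_iff[OF runit_hom[OF unit_obj] runit_iso[OF unit_obj] munit_hom] by simp
qed

lemma unit_in_Il:
  assumes pure: "right_pure V (MUnit S)"
  shows "(UnitO V, MUnit S) \<in> monos_into V (MObj S)" and "is_iso V (action (MUnit S))"
  using unit_mono[OF pure] munit_hom munit_right runit_iso[OF mobj_obj]
  by (simp_all add: monos_into_iff)

theorem Il_monoid_is_monoid:
  assumes pure: "right_pure V (MUnit S)"
  shows "monoid (Il_monoid V S)"
proof -
  let ?cl = "subobj V (MObj S)"
  \<comment> \<open>Collected in one statement so that it can be applied again to its own result.\<close>
  have mult: "Il_mult V S (?cl (J, i)) (?cl (K, k)) = ?cl (J \<otimes>\<^sub>o K, product i k) \<and>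
      product i k \<in> Hom V (J \<otimes>\<^sub>o K) (MObj S) \<and> is_iso V (action (product i k)) \<and>
      (J \<otimes>\<^sub>o K, product i k) \<in> monos_into V (MObj S) \<and>
      ?cl (J \<otimes>\<^sub>o K, product i k) \<in> Il V S"
    if J: "(J, i) \<in> monos_into V (MObj S)" "is_iso V (action i)"
    and K: "(K, k) \<in> monos_into V (MObj S)" "is_iso V (action k)" for J i K k
  proof -
    have i: "i \<in> Hom V J (MObj S)" and k: "k \<in> Hom V K (MObj S)"
      using J K by (auto simp: monos_into_iff)
    note ik = product_hom[OF i k] and mono = product_mono[OF pure i J(2) k K(2)]
    have m: "(J \<otimes>\<^sub>o K, product i k) \<in> monos_into V (MObj S)"
      using ik mono by (simp add: monos_into_iff)
    show ?thesis
      using Il_mult_subobj[OF J(1) K(1) mono] ik m action_product_iso[OF i J(2) k K(2)]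
        subobj_in_Il_iff[OF m] by blast
  qed
  note unit = unit_in_Il[OF pure]
  show ?thesis
  proof (rule monoidI)
    fix x y assume "x \<in> carrier (Il_monoid V S)" and "y \<in> carrier (Il_monoid V S)"
    then show "x \<otimes>\<^bsub>Il_monoid V S\<^esub> y \<in> carrier (Il_monoid V S)"
      using mult by (auto simp: Il_monoid_def elim!: IlE)
  next
    show "\<one>\<^bsub>Il_monoid V S\<^esub> \<in> carrier (Il_monoid V S)"
      using subobj_in_Il_iff[OF unit(1)] unit(2) by (simp add: Il_monoid_def)
  next
    fix x y z
    assume "x \<in> carrier (Il_monoid V S)" "y \<in> carrier (Il_monoid V S)" "z \<in> carrier (Il_monoid V S)"
    then have "x \<in> Il V S" "y \<in> Il V S" "z \<in> Il V S" by (simp_all add: Il_monoid_def)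
    then obtain J i K k L l
      where i: "(J, i) \<in> monos_into V (MObj S)" "x = ?cl (J, i)" "i \<in> Hom V J (MObj S)"
          "is_iso V (action i)"
        and k: "(K, k) \<in> monos_into V (MObj S)" "y = ?cl (K, k)" "k \<in> Hom V K (MObj S)"
          "is_iso V (action k)"
        and l: "(L, l) \<in> monos_into V (MObj S)" "z = ?cl (L, l)" "l \<in> Hom V L (MObj S)"
          "is_iso V (action l)"
      by (metis IlE)
    have obj: "J \<in> Obj V" "K \<in> Obj V" "L \<in> Obj V" using hom_objD i(3) k(3) l(3) by blast+
    note ik = mult[OF i(1,4) k(1,4)] and kl = mult[OF k(1,4) l(1,4)]
    have ik_l: "Il_mult V S (?cl (J \<otimes>\<^sub>o K, product i k)) (?cl (L, l))
        = ?cl ((J \<otimes>\<^sub>o K) \<otimes>\<^sub>o L, product (product i k) l)"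
      using mult[OF _ _ l(1,4)] ik by blast
    have i_kl: "Il_mult V S (?cl (J, i)) (?cl (K \<otimes>\<^sub>o L, product k l))
        = ?cl (J \<otimes>\<^sub>o (K \<otimes>\<^sub>o L), product i (product k l))"
      and m: "(J \<otimes>\<^sub>o (K \<otimes>\<^sub>o L), product i (product k l)) \<in> monos_into V (MObj S)"
      using mult[OF i(1,4)] kl by blast+
    have "?cl ((J \<otimes>\<^sub>o K) \<otimes>\<^sub>o L, product (product i k) l)
        = ?cl (J \<otimes>\<^sub>o (K \<otimes>\<^sub>o L), product i (product k l))"
      using subobj_eqI[OF assoc_hom assoc_iso m] obj product_assoc[OF i(3) k(3) l(3)] by simp
    then show "x \<otimes>\<^bsub>Il_monoid V S\<^esub> y \<otimes>\<^bsub>Il_monoid V S\<^esub> z = x \<otimes>\<^bsub>Il_monoid V S\<^esub> (y \<otimes>\<^bsub>Il_monoid V S\<^esub> z)"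
      using ik kl ik_l i_kl i(2) k(2) l(2) by (simp add: Il_monoid_def)
  next
    fix x assume "x \<in> carrier (Il_monoid V S)"
    then obtain J i where i: "(J, i) \<in> monos_into V (MObj S)" "x = ?cl (J, i)"
        "i \<in> Hom V J (MObj S)" "is_iso V (action i)"
      using IlE by (auto simp: Il_monoid_def)
    have J: "J \<in> Obj V" using hom_objD[OF i(3)] by blast
    have "?cl (UnitO V \<otimes>\<^sub>o J, product (MUnit S) i) = ?cl (J, i)"
      using subobj_eqI[OF lunit_hom[OF J] lunit_iso[OF J] i(1)] unit_product[OF i(3)] by simp
    then show "\<one>\<^bsub>Il_monoid V S\<^esub> \<otimes>\<^bsub>Il_monoid V S\<^esub> x = x"
      using mult[OF unit i(1,4)] i(2) by (simp add: Il_monoid_def)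
    have "?cl (J \<otimes>\<^sub>o UnitO V, product i (MUnit S)) = ?cl (J, i)"
      using subobj_eqI[OF runit_hom[OF J] runit_iso[OF J] i(1)] product_unit[OF i(3)] by simp
    then show "x \<otimes>\<^bsub>Il_monoid V S\<^esub> \<one>\<^bsub>Il_monoid V S\<^esub> = x"
      using mult[OF i(1,4) unit] i(2) by (simp add: Il_monoid_def)
  qed
qed

end


section \<open>Monoidal equivalences are fully faithful and essentially surjective\<close>

text \<open>The intrinsic form of an equivalence: arrows into \<open>F X\<close> can be moved back to \<open>V\<close>, up to an
  isomorphism of their domain. This is how subobjects are transported.\<close>

locale weak_monoidal_equivalence = strong_monoidal_functor V V' F
  for V :: "('o, 'a) monoidal_category"
    and V' :: "('p, 'b) monoidal_category"
    and F :: "('o, 'a, 'p, 'b) mon_functor" +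
  assumes faithful: "\<lbrakk>f \<in> Hom V X Y; g \<in> Hom V X Y; MapA F f = MapA F g\<rbrakk> \<Longrightarrow> f = g"
    and full: "\<lbrakk>X \<in> Obj V; Y \<in> Obj V; h \<in> Hom V' (MapO F X) (MapO F Y)\<rbrakk>
      \<Longrightarrow> \<exists>f \<in> Hom V X Y. MapA F f = h"
    and essentially_surjective: "W \<in> Obj V' \<Longrightarrow>
      \<exists>X \<in> Obj V. \<exists>u \<in> Hom V' W (MapO F X). is_iso V' u"


text \<open>Naturality of \<open>\<epsilon> : GF \<cong> 1\<close> recovers \<open>f\<close> from \<open>GFf\<close>, so \<open>F\<close> is faithful; likewise \<open>\<eta> : 1 \<cong> FG\<close>
  makes \<open>G\<close> faithful and \<open>F\<close> essentially surjective. For fullness, \<open>h : FX \<rightarrow> FY\<close> is the image of the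
  arrow \<open>f = \<epsilon>\<^sub>Y \<cdot> Gh \<cdot> \<epsilon>\<^sub>X\<^sup>-\<^sup>1\<close>: naturality gives \<open>GFf = Gh\<close>, and \<open>G\<close> is faithful.\<close>

theorem strong_monoidal_equivalence_imp_weak:
  assumes "strong_monoidal_equivalence V V' F"
  shows "weak_monoidal_equivalence V V' F"
proof -
  from assms have "strong_monoidal_functor V V' F"
    by (simp add: strong_monoidal_equivalence_def)
  then interpret F: strong_monoidal_functor V V' F .
  from assms obtain G \<eta> \<epsilon> where G: "strong_monoidal_functor V' V G"
    and nat_\<eta>: "monoidal_nat_iso V' V' (id_mon_functor V') (comp_mon_functor V' F G) \<eta>"
    and nat_\<epsilon>: "monoidal_nat_iso V V (comp_mon_functor V G F) (id_mon_functor V) \<epsilon>"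
    unfolding strong_monoidal_equivalence_def by blast
  interpret G: strong_monoidal_functor V' V G by (rule G)
  have \<eta>: "\<eta> W \<in> Hom V' W (MapO F (MapO G W))" "is_iso V' (\<eta> W)" if "W \<in> Obj V'" for W
    using nat_\<eta> that by (auto simp: monoidal_nat_iso_def id_mon_functor_def comp_mon_functor_def)
  have \<eta>_natural: "\<eta> Y \<cdot>\<^bsub>V'\<^esub> f = MapA F (MapA G f) \<cdot>\<^bsub>V'\<^esub> \<eta> X" if "f \<in> Hom V' X Y" for f X Y
    using nat_\<eta> that by (auto simp: monoidal_nat_iso_def id_mon_functor_def comp_mon_functor_def)
  have \<epsilon>: "\<epsilon> X \<in> Hom V (MapO G (MapO F X)) X" "is_iso V (\<epsilon> X)" if "X \<in> Obj V" for X
    using nat_\<epsilon> that by (auto simp: monoidal_nat_iso_def id_mon_functor_def comp_mon_functor_def)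
  have \<epsilon>_natural: "\<epsilon> Y \<cdot>\<^bsub>V\<^esub> MapA G (MapA F f) = f \<cdot>\<^bsub>V\<^esub> \<epsilon> X" if "f \<in> Hom V X Y" for f X Y
    using nat_\<epsilon> that by (auto simp: monoidal_nat_iso_def id_mon_functor_def comp_mon_functor_def)
  have G_faithful: "f = g"
    if f: "f \<in> Hom V' X Y" and g: "g \<in> Hom V' X Y" and eq: "MapA G f = MapA G g" for f g X Y
  proof -
    have Y: "Y \<in> Obj V'" using F.target.hom_objD[OF f] by blast
    have "\<eta> Y \<cdot>\<^bsub>V'\<^esub> f = \<eta> Y \<cdot>\<^bsub>V'\<^esub> g"
      using \<eta>_natural[OF f] \<eta>_natural[OF g] eq by simp
    then show ?thesis
      using F.target.iso_mono[OF \<eta>[OF Y]] f g unfolding F.target.is_mono_iff[OF \<eta>(1)[OF Y]] by blast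
  qed
  show ?thesis
  proof (unfold_locales)
    fix f g X Y
    assume f: "f \<in> Hom V X Y" and g: "g \<in> Hom V X Y" and eq: "MapA F f = MapA F g"
    have X: "X \<in> Obj V" using F.source.hom_objD[OF f] by blast
    show "f = g"
      using F.source.iso_epi[OF \<epsilon>[OF X] f g] \<epsilon>_natural[OF f] \<epsilon>_natural[OF g] eq by simp
  next
    fix X Y h
    assume X: "X \<in> Obj V" and Y: "Y \<in> Obj V" and h: "h \<in> Hom V' (MapO F X) (MapO F Y)"
    obtain e where e: "e \<in> Hom V X (MapO G (MapO F X))"
        "e \<cdot>\<^bsub>V\<^esub> \<epsilon> X = Ident V (MapO G (MapO F X))"
      using F.source.isoE[OF \<epsilon>(2)[OF X] \<epsilon>(1)[OF X]] by metis
    let ?f = "\<epsilon> Y \<cdot>\<^bsub>V\<^esub> MapA G h \<cdot>\<^bsub>V\<^esub> e"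
    have Gh: "\<epsilon> Y \<cdot>\<^bsub>V\<^esub> MapA G h \<in> Hom V (MapO G (MapO F X)) Y"
      using F.source.comp_hom[OF G.map_hom[OF h] \<epsilon>(1)[OF Y]] .
    have f: "?f \<in> Hom V X Y"
      using F.source.comp_hom[OF e(1) Gh] .
    have GFf: "MapA G (MapA F ?f) \<in> Hom V (MapO G (MapO F X)) (MapO G (MapO F Y))"
      using G.map_hom[OF F.map_hom[OF f]] .
    have "\<epsilon> Y \<cdot>\<^bsub>V\<^esub> MapA G (MapA F ?f) = \<epsilon> Y \<cdot>\<^bsub>V\<^esub> MapA G h"
      using \<epsilon>_natural[OF f] F.source.comp_inverse_cancel(2)[OF \<epsilon>(1)[OF X] e Gh] by simp
    then have "MapA G (MapA F ?f) = MapA G h"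
      using F.source.iso_mono[OF \<epsilon>[OF Y]] GFf G.map_hom[OF h]
      unfolding F.source.is_mono_iff[OF \<epsilon>(1)[OF Y]] by blast
    then have "MapA F ?f = h"
      using G_faithful[OF F.map_hom[OF f] h] by blast
    then show "\<exists>f \<in> Hom V X Y. MapA F f = h" using f by blast
  next
    fix W assume "W \<in> Obj V'"
    then show "\<exists>X \<in> Obj V. \<exists>u \<in> Hom V' W (MapO F X). is_iso V' u"
      using \<eta> G.map_obj by blast
  qed
qed

context weak_monoidal_equivalence
begin

lemma map_iso_iff:
  assumes f: "f \<in> Hom V X Y"
  shows "is_iso V' (MapA F f) \<longleftrightarrow> is_iso V f"
proof
  have obj: "X \<in> Obj V" "Y \<in> Obj V" using source.hom_objD[OF f] by auto
  note id = source.ident_hom[OF obj(1)] source.ident_hom[OF obj(2)]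
  assume "is_iso V' (MapA F f)"
  then obtain h where h: "h \<in> Hom V' (MapO F Y) (MapO F X)"
      "h \<cdot>\<^bsub>V'\<^esub> MapA F f = Ident V' (MapO F X)" "MapA F f \<cdot>\<^bsub>V'\<^esub> h = Ident V' (MapO F Y)"
    using target.isoE[OF _ map_hom[OF f]] by blast
  obtain g where g: "g \<in> Hom V Y X" "MapA F g = h"
    using full[OF obj(2,1) h(1)] by blast
  have "g \<cdot>\<^bsub>V\<^esub> f = Ident V X"
    using faithful[OF source.comp_hom[OF f g(1)] id(1)] map_comp[OF f g(1)] map_ident obj g(2) h
    by simp
  moreover have "f \<cdot>\<^bsub>V\<^esub> g = Ident V Y"
    using faithful[OF source.comp_hom[OF g(1) f] id(2)] map_comp[OF g(1) f] map_ident obj g(2) h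
    by simp
  ultimately show "is_iso V f"
    using source.is_iso_iff[OF f] g(1) by blast
next
  have obj: "X \<in> Obj V" "Y \<in> Obj V" using source.hom_objD[OF f] by auto
  assume "is_iso V f"
  then obtain g where g: "g \<in> Hom V Y X" "g \<cdot>\<^bsub>V\<^esub> f = Ident V X" "f \<cdot>\<^bsub>V\<^esub> g = Ident V Y"
    using source.isoE[OF _ f] by blast
  have "MapA F g \<cdot>\<^bsub>V'\<^esub> MapA F f = Ident V' (MapO F X)"
    and "MapA F f \<cdot>\<^bsub>V'\<^esub> MapA F g = Ident V' (MapO F Y)"
    using map_comp[OF f g(1)] map_comp[OF g(1) f] g map_ident obj by simp_all
  then show "is_iso V' (MapA F f)"
    using target.is_iso_iff[OF map_hom[OF f]] map_hom[OF g(1)] by blast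
qed

text \<open>Faithfulness gives reflection. For preservation, the test arrows have an arbitrary domain
  \<open>W\<close> in the target; replacing \<open>W\<close> by an isomorphic \<open>F W\<^sub>0\<close> turns them into images of arrows of \<open>V\<close>.\<close>

lemma map_mono_iff:
  assumes f: "f \<in> Hom V X Y"
  shows "is_mono V' (MapA F f) \<longleftrightarrow> is_mono V f"
proof
  assume mono: "is_mono V' (MapA F f)"
  show "is_mono V f"
    unfolding source.is_mono_iff[OF f]
  proof (intro allI ballI impI)
    fix W g h
    assume g: "g \<in> Hom V W X" and h: "h \<in> Hom V W X" and eq: "f \<cdot>\<^bsub>V\<^esub> g = f \<cdot>\<^bsub>V\<^esub> h"
    have "MapA F f \<cdot>\<^bsub>V'\<^esub> MapA F g = MapA F f \<cdot>\<^bsub>V'\<^esub> MapA F h"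
      using map_comp[OF g f] map_comp[OF h f] eq by simp
    then have "MapA F g = MapA F h"
      using mono map_hom[OF g] map_hom[OF h] unfolding target.is_mono_iff[OF map_hom[OF f]] by blast
    then show "g = h" by (rule faithful[OF g h])
  qed
next
  have X: "X \<in> Obj V" using source.hom_objD[OF f] by auto
  assume mono: "is_mono V f"
  show "is_mono V' (MapA F f)"
    unfolding target.is_mono_iff[OF map_hom[OF f]]
  proof (intro allI ballI impI)
    fix W g h
    assume g: "g \<in> Hom V' W (MapO F X)" and h: "h \<in> Hom V' W (MapO F X)"
      and eq: "MapA F f \<cdot>\<^bsub>V'\<^esub> g = MapA F f \<cdot>\<^bsub>V'\<^esub> h"
    have "W \<in> Obj V'" using target.hom_objD[OF g] by blast
    then obtain W0 u where W0: "W0 \<in> Obj V" and u: "u \<in> Hom V' W (MapO F W0)" "is_iso V' u"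
      using essentially_surjective by blast
    obtain v where v: "v \<in> Hom V' (MapO F W0) W" "is_iso V' v"
      using target.isoE[OF u(2,1)] by blast
    obtain g0 where g0: "g0 \<in> Hom V W0 X" "MapA F g0 = g \<cdot>\<^bsub>V'\<^esub> v"
      using full[OF W0 X target.comp_hom[OF v(1) g]] by blast
    obtain h0 where h0: "h0 \<in> Hom V W0 X" "MapA F h0 = h \<cdot>\<^bsub>V'\<^esub> v"
      using full[OF W0 X target.comp_hom[OF v(1) h]] by blast
    have "MapA F (f \<cdot>\<^bsub>V\<^esub> g0) = MapA F (f \<cdot>\<^bsub>V\<^esub> h0)"
      using map_comp[OF g0(1) f] map_comp[OF h0(1) f] g0(2) h0(2) eq
        target.comp_assoc[OF v(1) g map_hom[OF f]] target.comp_assoc[OF v(1) h map_hom[OF f]]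
      by simp
    then have "f \<cdot>\<^bsub>V\<^esub> g0 = f \<cdot>\<^bsub>V\<^esub> h0"
      using faithful[OF source.comp_hom[OF g0(1) f] source.comp_hom[OF h0(1) f]] by blast
    then have "g0 = h0"
      using mono g0(1) h0(1) unfolding source.is_mono_iff[OF f] by blast
    then show "g = h"
      using target.iso_epi[OF v g h] g0(2) h0(2) by simp
  qed
qed

lemma monos_into_map_iff:
  "i \<in> Hom V J X \<Longrightarrow>
    (MapO F J, MapA F i) \<in> monos_into V' (MapO F X) \<longleftrightarrow> (J, i) \<in> monos_into V X"
  using map_hom map_mono_iff source.monos_into_iff target.monos_into_iff by metis

lemma subobj_rel_map_iff:
  assumes J: "(J, i) \<in> monos_into V X" and K: "(K, k) \<in> monos_into V X"
  shows "((MapO F J, MapA F i), (MapO F K, MapA F k)) \<in> subobj_rel V' (MapO F X)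
    \<longleftrightarrow> ((J, i), (K, k)) \<in> subobj_rel V X"
proof -
  have i: "i \<in> Hom V J X" and k: "k \<in> Hom V K X"
    using J K by (auto simp: source.monos_into_iff)
  have obj: "J \<in> Obj V" "K \<in> Obj V" using source.hom_objD i k by blast+
  show ?thesis
  proof
    assume "((MapO F J, MapA F i), (MapO F K, MapA F k)) \<in> subobj_rel V' (MapO F X)"
    then obtain h' where h': "h' \<in> Hom V' (MapO F J) (MapO F K)" "is_iso V' h'"
        "MapA F k \<cdot>\<^bsub>V'\<^esub> h' = MapA F i"
      using target.subobj_relE by metis
    obtain h where h: "h \<in> Hom V J K" "MapA F h = h'"
      using full[OF obj h'(1)] by blast
    have "k \<cdot>\<^bsub>V\<^esub> h = i"
      using faithful[OF source.comp_hom[OF h(1) k] i] map_comp[OF h(1) k] h(2) h'(3) by simp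
    then show "((J, i), (K, k)) \<in> subobj_rel V X"
      using source.subobj_relI[OF h(1) _ K] map_iso_iff[OF h(1)] h(2) h'(2) by simp
  next
    assume "((J, i), (K, k)) \<in> subobj_rel V X"
    then obtain h where h: "h \<in> Hom V J K" "is_iso V h" "k \<cdot>\<^bsub>V\<^esub> h = i"
      using source.subobj_relE by metis
    then show "((MapO F J, MapA F i), (MapO F K, MapA F k)) \<in> subobj_rel V' (MapO F X)"
      using target.subobj_relI[OF map_hom[OF h(1)]] map_iso_iff[OF h(1)] monos_into_map_iff[OF k] K
        map_comp[OF h(1) k] by simp
  qed
qed

lemma subobj_map_eq_iff:
  assumes J: "(J, i) \<in> monos_into V X" and K: "(K, k) \<in> monos_into V X"
  shows "subobj V' (MapO F X) (MapO F J, MapA F i) = subobj V' (MapO F X) (MapO F K, MapA F k)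
    \<longleftrightarrow> subobj V X (J, i) = subobj V X (K, k)"
proof -
  have "(MapO F J, MapA F i) \<in> monos_into V' (MapO F X)"
    and "(MapO F K, MapA F k) \<in> monos_into V' (MapO F X)"
    using J K monos_into_map_iff by (auto simp: source.monos_into_iff)
  then show ?thesis
    using target.subobj_eq_iff source.subobj_eq_iff[OF J K] subobj_rel_map_iff[OF J K] by blast
qed

lemma subobj_map_subobj:
  assumes J: "(J, i) \<in> monos_into V (MObj S)"
  shows "subobj_map V' F S (subobj V (MObj S) (J, i))
    = subobj V' (MapO F (MObj S)) (MapO F J, MapA F i)"
proof -
  have "subobj V' (MapO F (MObj S)) (MapO F K, MapA F k)
      = subobj V' (MapO F (MObj S)) (MapO F J, MapA F i)"
    if "(K, k) \<in> subobj V (MObj S) (J, i)" for K k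
  proof -
    have "((J, i), (K, k)) \<in> subobj_rel V (MObj S)"
      using that by (simp add: subobj_def)
    then have K: "(K, k) \<in> monos_into V (MObj S)"
      and "subobj V (MObj S) (J, i) = subobj V (MObj S) (K, k)"
      using source.subobj_eq_iff[OF J] by (auto simp: subobj_rel_def)
    then show ?thesis using subobj_map_eq_iff[OF J K] by simp
  qed
  then show ?thesis
    unfolding subobj_map_def using source.subobj_self[OF J] by blast
qed

text \<open>An isomorphism \<open>u : J' \<rightarrow> F J\<close> turns \<open>i'\<close> into an arrow \<open>F J \<rightarrow> F X\<close> representing the same subobject,
  and this arrow is an image because \<open>F\<close> is full.\<close>

lemma subobject_preimage:
  assumes J': "(J', i') \<in> monos_into V' (MapO F X)" and X: "X \<in> Obj V"
  obtains J i where "(J, i) \<in> monos_into V X"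
    and "subobj V' (MapO F X) (J', i') = subobj V' (MapO F X) (MapO F J, MapA F i)"
proof -
  have i': "i' \<in> Hom V' J' (MapO F X)" "is_mono V' i'"
    using J' by (auto simp: target.monos_into_iff)
  obtain J u where J: "J \<in> Obj V" and u: "u \<in> Hom V' J' (MapO F J)" "is_iso V' u"
    using essentially_surjective target.hom_objD[OF i'(1)] by blast
  obtain v where v: "v \<in> Hom V' (MapO F J) J'" "v \<cdot>\<^bsub>V'\<^esub> u = Ident V' J'" "is_iso V' v"
    using target.isoE[OF u(2,1)] by metis
  obtain i where i: "i \<in> Hom V J X" "MapA F i = i' \<cdot>\<^bsub>V'\<^esub> v"
    using full[OF J X target.comp_hom[OF v(1) i'(1)]] by blast
  have Fi: "(MapO F J, MapA F i) \<in> monos_into V' (MapO F X)"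
    using target.mono_comp_right_iff[OF v(1,3) i'(1)] i'(2) i(2) map_hom[OF i(1)]
    by (simp add: target.monos_into_iff)
  have "MapA F i \<cdot>\<^bsub>V'\<^esub> u = i'"
    using target.comp_inverse_cancel(2)[OF u(1) v(1,2) i'(1)] i(2) by simp
  then show ?thesis
    using that monos_into_map_iff[OF i(1)] Fi target.subobj_eqI[OF u Fi] by blast
qed

end


section \<open>Transport of left invertible subobjects\<close>

locale magma_image = weak_monoidal_equivalence V V' F + S: magma_object V S
  for V :: "('o, 'a) monoidal_category"
    and V' :: "('p, 'b) monoidal_category"
    and F :: "('o, 'a, 'p, 'b) mon_functor"
    and S :: "('o, 'a) monoid_object"
begin

sublocale image: magma_object V' "image_monoid_object V' F S"
  by unfold_locales
    (use map_obj[OF S.magma_obj]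
        target.comp_hom[OF str_hom[OF S.magma_obj S.magma_obj] map_hom[OF S.magma_mult_hom]] in
      \<open>simp_all add: image_monoid_object_def\<close>)

lemma image_obj [simp]: "MObj (image_monoid_object V' F S) = MapO F (MObj S)"
  by (simp add: image_monoid_object_def)

text \<open>Naturality of the structure isomorphism, seen through the definition of the multiplication of
  the image monoid.\<close>

lemma image_product:
  assumes i: "i \<in> Hom V J (MObj S)" and k: "k \<in> Hom V K (MObj S)"
  shows "image.product (MapA F i) (MapA F k) = MapA F (S.product i k) \<cdot>\<^bsub>V'\<^esub> Str F J K"
proof -
  have obj: "J \<in> Obj V" "K \<in> Obj V" using source.hom_objD i k by blast+
  note m = map_hom[OF S.magma_mult_hom] and ik = source.tensor_hom[OF i k]
  have "image.product (MapA F i) (MapA F k)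
      = MapA F (MMult S) \<cdot>\<^bsub>V'\<^esub> (Str F (MObj S) (MObj S) \<cdot>\<^bsub>V'\<^esub> (MapA F i \<otimes>\<^sub>a\<^bsub>V'\<^esub> MapA F k))"
    using target.comp_assoc[OF target.tensor_hom[OF map_hom[OF i] map_hom[OF k]]
        str_hom[OF S.magma_obj S.magma_obj] m]
    by (simp add: image_monoid_object_def)
  also have "\<dots> = MapA F (MMult S) \<cdot>\<^bsub>V'\<^esub> (MapA F (i \<otimes>\<^sub>a\<^bsub>V\<^esub> k) \<cdot>\<^bsub>V'\<^esub> Str F J K)"
    using str_natural[OF i k] by simp
  also have "\<dots> = MapA F (MMult S) \<cdot>\<^bsub>V'\<^esub> MapA F (i \<otimes>\<^sub>a\<^bsub>V\<^esub> k) \<cdot>\<^bsub>V'\<^esub> Str F J K"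
    using target.comp_assoc[OF str_hom[OF obj] map_hom[OF ik] m] by simp
  finally show ?thesis
    using map_comp[OF ik S.magma_mult_hom] by simp
qed

lemma image_action_iso_iff:
  assumes i: "i \<in> Hom V J (MObj S)"
  shows "is_iso V' (image.action (MapA F i)) \<longleftrightarrow> is_iso V (S.action i)"
proof -
  have J: "J \<in> Obj V" using source.hom_objD[OF i] by blast
  have "image.action (MapA F i) = MapA F (S.action i) \<cdot>\<^bsub>V'\<^esub> Str F (MObj S) J"
    using image_product[OF source.ident_hom[OF S.magma_obj] i] map_ident[OF S.magma_obj] by simp
  then show ?thesis
    using target.iso_comp_right_iff[OF str_hom[OF S.magma_obj J] str_iso[OF S.magma_obj J]
        map_hom[OF S.action_hom[OF i]]] map_iso_iff[OF S.action_hom[OF i]] by simp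
qed

lemma subobj_map_in_Il_iff:
  assumes J: "(J, i) \<in> monos_into V (MObj S)"
  shows "subobj V' (MapO F (MObj S)) (MapO F J, MapA F i) \<in> Il V' (image_monoid_object V' F S)
    \<longleftrightarrow> subobj V (MObj S) (J, i) \<in> Il V S"
proof -
  have i: "i \<in> Hom V J (MObj S)" using J by (simp add: source.monos_into_iff)
  have "(MapO F J, MapA F i) \<in> monos_into V' (MapO F (MObj S))"
    using J monos_into_map_iff[OF i] by blast
  then show ?thesis
    using image.subobj_in_Il_iff S.subobj_in_Il_iff[OF J] image_action_iso_iff[OF i] by simp
qed

theorem subobj_map_bij:
  "bij_betw (subobj_map V' F S) (Il V S) (Il V' (image_monoid_object V' F S))"
proof (rule bij_betwI')
  fix x y assume "x \<in> Il V S" and "y \<in> Il V S"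
  then show "subobj_map V' F S x = subobj_map V' F S y \<longleftrightarrow> x = y"
    by (auto elim!: S.IlE simp: subobj_map_subobj subobj_map_eq_iff)
next
  fix x assume "x \<in> Il V S"
  then show "subobj_map V' F S x \<in> Il V' (image_monoid_object V' F S)"
    using subobj_map_in_Il_iff subobj_map_subobj by (metis S.IlE)
next
  fix y assume y: "y \<in> Il V' (image_monoid_object V' F S)"
  then obtain J' i' where J': "(J', i') \<in> monos_into V' (MapO F (MObj S))"
      "y = subobj V' (MapO F (MObj S)) (J', i')"
    using image.IlE by (metis image_obj)
  obtain J i where J: "(J, i) \<in> monos_into V (MObj S)"
      and "y = subobj V' (MapO F (MObj S)) (MapO F J, MapA F i)"
    using subobject_preimage[OF J'(1) S.magma_obj] J'(2) by metis
  then show "\<exists>x \<in> Il V S. y = subobj_map V' F S x"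
    using subobj_map_in_Il_iff[OF J] subobj_map_subobj[OF J] y by metis
qed

text \<open>By \<open>image_product\<close> the two sides are represented by arrows that differ by the structure
  isomorphism \<open>F J \<otimes> F K \<rightarrow> F (J \<otimes> K)\<close>. In particular the product in the image is a monomorphism, as
  the formula for products of classes requires.\<close>

lemma subobj_map_mult:
  assumes J: "(J, i) \<in> monos_into V (MObj S)" and K: "(K, k) \<in> monos_into V (MObj S)"
    and mono: "is_mono V (S.product i k)"
  shows "subobj_map V' F S (Il_mult V S (subobj V (MObj S) (J, i)) (subobj V (MObj S) (K, k)))
    = Il_mult V' (image_monoid_object V' F S) (subobj_map V' F S (subobj V (MObj S) (J, i)))
        (subobj_map V' F S (subobj V (MObj S) (K, k)))"
proof -
  let ?S' = "image_monoid_object V' F S" and ?FS = "MapO F (MObj S)"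
  have i: "i \<in> Hom V J (MObj S)" and k: "k \<in> Hom V K (MObj S)"
    using J K by (auto simp: source.monos_into_iff)
  have obj: "J \<in> Obj V" "K \<in> Obj V" using source.hom_objD i k by blast+
  note str = str_hom[OF obj] str_iso[OF obj]
  note ik = S.product_hom[OF i k]
  have m: "(J \<otimes>\<^sub>o\<^bsub>V\<^esub> K, S.product i k) \<in> monos_into V (MObj S)"
    using ik mono by (simp add: source.monos_into_iff)
  have Fm: "(MapO F (J \<otimes>\<^sub>o\<^bsub>V\<^esub> K), MapA F (S.product i k)) \<in> monos_into V' ?FS"
    using m monos_into_map_iff[OF ik] by blast
  have FJ: "(MapO F J, MapA F i) \<in> monos_into V' ?FS" and FK: "(MapO F K, MapA F k) \<in> monos_into V' ?FS"
    using J K monos_into_map_iff i k by blast+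
  have "is_mono V' (image.product (MapA F i) (MapA F k))"
    using target.mono_comp_right_iff[OF str map_hom[OF ik]] map_mono_iff[OF ik] mono
      image_product[OF i k] by simp
  then have "Il_mult V' ?S' (subobj V' ?FS (MapO F J, MapA F i)) (subobj V' ?FS (MapO F K, MapA F k))
      = subobj V' ?FS (MapO F J \<otimes>\<^sub>o\<^bsub>V'\<^esub> MapO F K, image.product (MapA F i) (MapA F k))"
    using image.Il_mult_subobj FJ FK by simp
  also have "\<dots> = subobj V' ?FS (MapO F (J \<otimes>\<^sub>o\<^bsub>V\<^esub> K), MapA F (S.product i k))"
    using target.subobj_eqI[OF str Fm] image_product[OF i k] by simp
  finally show ?thesis
    using S.Il_mult_subobj[OF J K mono] subobj_map_subobj J K m by simp
qed

lemma subobj_map_unit: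
  assumes e: "(UnitO V, MUnit S) \<in> monos_into V (MObj S)"
  shows "subobj_map V' F S (subobj V (MObj S) (UnitO V, MUnit S))
    = subobj V' (MapO F (MObj S)) (UnitO V', MUnit (image_monoid_object V' F S))"
proof -
  have "MUnit S \<in> Hom V (UnitO V) (MObj S)" using e by (simp add: source.monos_into_iff)
  then have "(MapO F (UnitO V), MapA F (MUnit S)) \<in> monos_into V' (MapO F (MObj S))"
    using e monos_into_map_iff by blast
  then show ?thesis
    using target.subobj_eqI[OF str0_hom str0_iso] subobj_map_subobj[OF e]
    by (simp add: image_monoid_object_def)
qed

end

theorem proposition2p8:
  fixes V :: "('o, 'a) monoidal_category"
    and V' :: "('p, 'b) monoidal_category"
    and \<Phi> :: "('o, 'a, 'p, 'b) mon_functor"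
    and S :: "('o, 'a) monoid_object"
  assumes "monoidal_category V"
    and "monoidal_category V'"
    and "strong_monoidal_equivalence V V' \<Phi>"
    and "monoid_object V S"
  defines "\<phi>S \<equiv> subobj_map V' \<Phi> S"
    and "S' \<equiv> image_monoid_object V' \<Phi> S"
  shows "(\<forall>(J, i) \<in> monos_into V (MObj S). subobj V (MObj S) (J, i) \<in> Il V S \<longrightarrow>
           \<phi>S (subobj V (MObj S) (J, i)) = subobj V' (MObj S') (MapO \<Phi> J, MapA \<Phi> i))
       \<and> bij_betw \<phi>S (Il V S) (Il V' S')
       \<and> (right_pure V (MUnit S) \<longrightarrow>
            monoid (Il_monoid V S) \<and> monoid (Il_monoid V' S') \<and>
            \<phi>S \<in> iso (Il_monoid V S) (Il_monoid V' S') \<and>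
            \<phi>S \<one>\<^bsub>Il_monoid V S\<^esub> = \<one>\<^bsub>Il_monoid V' S'\<^esub>)"
proof -
  interpret weak_monoidal_equivalence V V' \<Phi>
    using assms(3) by (rule strong_monoidal_equivalence_imp_weak)
  interpret S: monoid_object V S by (rule assms(4))
  interpret magma_image V V' \<Phi> S ..
  have S'_obj: "MObj S' = MapO \<Phi> (MObj S)" by (simp add: S'_def)
  have bij: "bij_betw \<phi>S (Il V S) (Il V' S')"
    unfolding \<phi>S_def S'_def by (rule subobj_map_bij)
  show ?thesis
  proof (intro conjI impI)
    show "\<forall>(J, i) \<in> monos_into V (MObj S). subobj V (MObj S) (J, i) \<in> Il V S \<longrightarrow>
           \<phi>S (subobj V (MObj S) (J, i)) = subobj V' (MObj S') (MapO \<Phi> J, MapA \<Phi> i)"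
      using subobj_map_subobj by (auto simp: \<phi>S_def S'_obj)
    show "bij_betw \<phi>S (Il V S) (Il V' S')" by (rule bij)
  next
    let ?M = "Il_monoid V S" and ?M' = "Il_monoid V' S'"
    assume pure: "right_pure V (MUnit S)"
    show monoid: "monoid ?M" by (rule S.Il_monoid_is_monoid[OF pure])
    have "\<phi>S (x \<otimes>\<^bsub>?M\<^esub> y) = \<phi>S x \<otimes>\<^bsub>?M'\<^esub> \<phi>S y" if x: "x \<in> Il V S" and y: "y \<in> Il V S" for x y
    proof -
      obtain J i where J: "(J, i) \<in> monos_into V (MObj S)" "x = subobj V (MObj S) (J, i)"
          "i \<in> Hom V J (MObj S)" "is_iso V (S.action i)"
        using S.IlE[OF x] by blast
      obtain K k where K: "(K, k) \<in> monos_into V (MObj S)" "y = subobj V (MObj S) (K, k)"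
          "k \<in> Hom V K (MObj S)" "is_iso V (S.action k)"
        using S.IlE[OF y] by blast
      show ?thesis
        using subobj_map_mult[OF J(1) K(1) S.product_mono[OF pure J(3,4) K(3,4)]] J(2) K(2)
        by (simp add: Il_monoid_def \<phi>S_def S'_def)
    qed
    then show iso: "\<phi>S \<in> iso ?M ?M'"
      using bij bij_betwE[OF bij] by (auto simp: iso_def hom_def Il_monoid_def)
    show one: "\<phi>S \<one>\<^bsub>?M\<^esub> = \<one>\<^bsub>?M'\<^esub>"
      using subobj_map_unit[OF S.unit_in_Il(1)[OF pure]]
      by (simp add: Il_monoid_def \<phi>S_def S'_def)
    \<comment> \<open>The image of a monoid under a homomorphism is a monoid; here the image is all of \<open>?M'\<close>,
      with the unit of \<open>?M'\<close>.\<close>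
    have "monoid (?M' \<lparr>carrier := \<phi>S ` carrier ?M, one := \<phi>S \<one>\<^bsub>?M\<^esub>\<rparr>)"
      using monoid.hom_imp_img_monoid[OF monoid] iso unfolding iso_def by blast
    moreover have "\<phi>S ` carrier ?M = carrier ?M'"
      using bij by (simp add: bij_betw_def Il_monoid_def)
    ultimately show "monoid ?M'"
      using one by simp
  qed
qed

end
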